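(* Let $G=(V,E)$ be a connected, undirected, simple graph that is not a cycle, and let $n_M$ be the total number of vertices lying in maximal $2$-edge-connected components of $G$. Then every pebble permutation instance $(G,S,\Pi)$ with $p\le n_M-3$ pebbles is feasible.
   Context: A maximal 2-edge-connected component of $G$ is a subgraph with at least two vertices that stays connected after deleting any single edge and is not contained in any larger such subgraph of $G$. Pebbles are labeled $1,\dots,p$. A configuration is an injective map $S:\{1,\dots,p\}\to V$, written $S=\langle s_1,\dots,s_p\rangle$. A move is a pair of configurations differing at exactly one pebble $i$, with $(s_i,s_i')\in E$. Two configurations are connected if one is obtained from the other by a finite sequence of moves. A pebble permutation instance $(G,S,\Pi)$, with $\Pi$ a permutation of $\{1,\dots,p\}$, is feasible if $S$ is connected to the configuration $D$ with $d_i=s_{\Pi(i)}$ for all $i$. *)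

theory Defs
  imports "Graph_Theory.Digraph_Component" "HOL-Combinatorics.Permutations" "HOL-Library.FuncSet"
begin

text \<open>
  A finite simple undirected graph is a \<^const>\<open>pair_graph\<close>: an edge between \<open>u\<close> and \<open>v\<close> is
  the pair of opposite arcs \<open>(u, v)\<close> and \<open>(v, u)\<close>, so deleting an edge removes both.
\<close>

definition delete_edge :: "'a pair_pre_digraph \<Rightarrow> 'a \<Rightarrow> 'a \<Rightarrow> 'a pair_pre_digraph" where
  "delete_edge G u v = \<lparr> pverts = pverts G, parcs = parcs G - {(u, v), (v, u)} \<rparr>"

text \<open>
  Length at least three rules out the closed walk \<open>u, v, u\<close>, which \<^const>\<open>pre_digraph.cycle\<close>
  accepts in a symmetric digraph.
\<close>

definition is_cycle_graph :: "'a pair_pre_digraph \<Rightarrow> bool" where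
  "is_cycle_graph G \<longleftrightarrow>
    (\<exists>c. pre_digraph.cycle (with_proj G) c \<and> 3 \<le> length c \<and>
         pverts G = fst ` set c \<and> parcs G = set c \<union> (set c)\<inverse>)"

definition two_edge_connected :: "'a pair_pre_digraph \<Rightarrow> bool" where
  "two_edge_connected H \<longleftrightarrow>
    2 \<le> card (pverts H) \<and> Digraph_Component.connected (with_proj H) \<and>
    (\<forall>(u, v) \<in> parcs H. Digraph_Component.connected (with_proj (delete_edge H u v)))"

definition max_two_edge_connected_component ::
    "'a pair_pre_digraph \<Rightarrow> 'a pair_pre_digraph \<Rightarrow> bool" where
  "max_two_edge_connected_component G H \<longleftrightarrow>
    pair_graph H \<and> subgraph (with_proj H) (with_proj G) \<and> two_edge_connected H \<and>
    (\<forall>H'. pair_graph H' \<and> subgraph (with_proj H') (with_proj G) \<and> two_edge_connected H' \<and>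
          subgraph (with_proj H) (with_proj H') \<longrightarrow> H' = H)"

definition n_M :: "'a pair_pre_digraph \<Rightarrow> nat" where
  "n_M G = card (\<Union>H \<in> {H. max_two_edge_connected_component G H}. pverts H)"

definition configuration :: "'a pair_pre_digraph \<Rightarrow> nat \<Rightarrow> (nat \<Rightarrow> 'a) \<Rightarrow> bool" where
  "configuration G p S \<longleftrightarrow> S \<in> {1..p} \<rightarrow>\<^sub>E pverts G \<and> inj_on S {1..p}"

definition pebble_move ::
    "'a pair_pre_digraph \<Rightarrow> nat \<Rightarrow> (nat \<Rightarrow> 'a) \<Rightarrow> (nat \<Rightarrow> 'a) \<Rightarrow> bool" where
  "pebble_move G p S S' \<longleftrightarrow>
    configuration G p S \<and> configuration G p S' \<and>
    (\<exists>i. {j \<in> {1..p}. S j \<noteq> S' j} = {i} \<and> (S i, S' i) \<in> parcs G)"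

definition config_connected ::
    "'a pair_pre_digraph \<Rightarrow> nat \<Rightarrow> (nat \<Rightarrow> 'a) \<Rightarrow> (nat \<Rightarrow> 'a) \<Rightarrow> bool" where
  "config_connected G p = (pebble_move G p)\<^sup>*\<^sup>*"

definition pebble_permutation_instance ::
    "'a pair_pre_digraph \<Rightarrow> nat \<Rightarrow> (nat \<Rightarrow> 'a) \<Rightarrow> (nat \<Rightarrow> nat) \<Rightarrow> bool" where
  "pebble_permutation_instance G p S \<pi> \<longleftrightarrow> configuration G p S \<and> \<pi> permutes {1..p}"

definition feasible ::
    "'a pair_pre_digraph \<Rightarrow> nat \<Rightarrow> (nat \<Rightarrow> 'a) \<Rightarrow> (nat \<Rightarrow> nat) \<Rightarrow> bool" where
  "feasible G p S \<pi> \<longleftrightarrow> config_connected G p S (\<lambda>i \<in> {1..p}. S (\<pi> i))"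

end

theory Submission
  imports Defs
begin

text \<open>
  Call two pebbles exchangeable in a configuration if the configuration with just these two swapped
  can be reached. This is an equivalence relation on pebbles, it is invariant under moves, and it
  suffices to show that all pebbles are equivalent. On a cycle with one pendant edge, two holes make
  all pebbles equivalent: rotate until two neighbouring pebbles meet the junction and swap them
  there. Sets of vertices on which three holes make all pebbles equivalent can be enlarged cycle by
  cycle, because the holes can be parked in an overlap together with a common pebble, or next to a
  bridge over which a pebble is carried.

  The vertices of the maximal 2-edge-connected components lie on cycles. Let \<open>M\<close> be the set of
  vertices on cycles. First move all pebbles into \<open>M\<close>, where at least three holes remain. As the
  other vertices are now empty, they can be contracted: a pebble passes between two vertices of \<open>M\<close>
  along any path whose interior avoids \<open>M\<close>. The enlargement argument applies to the contracted graph
  unless one cycle fills \<open>M\<close>. Such a cycle has a pendant edge or a chord, since the graph is not a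
  cycle, and a chord splits it into two smaller cycles.
\<close>

section \<open>Slides and exchangeable pebbles\<close>

text \<open>Moves over a bare relation, with no vertex set attached: the same lemmas then serve for
  \<open>E\<close>, for \<open>E\<close> restricted to a subset and for contracted edges.
  Configurations are total functions whose values off \<open>I\<close> never change.\<close>

definition slide :: "'b set \<Rightarrow> 'a rel \<Rightarrow> ('b \<Rightarrow> 'a) \<Rightarrow> ('b \<Rightarrow> 'a) \<Rightarrow> bool" where
  "slide I E S S' \<longleftrightarrow> (\<exists>i\<in>I. \<exists>v. (S i, v) \<in> E \<and> v \<notin> S ` I \<and> S' = S(i := v))"

definition reach :: "'b set \<Rightarrow> 'a rel \<Rightarrow> ('b \<Rightarrow> 'a) \<Rightarrow> ('b \<Rightarrow> 'a) \<Rightarrow> bool" where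
  "reach I E = (slide I E)\<^sup>*\<^sup>*"

definition exch :: "'b set \<Rightarrow> 'a rel \<Rightarrow> ('b \<Rightarrow> 'a) \<Rightarrow> 'b \<Rightarrow> 'b \<Rightarrow> bool" where
  "exch I E S i j \<longleftrightarrow> reach I E S (S \<circ> transpose i j)"

text \<open>Only holes inside \<open>K\<close> count, other pebbles may stand outside
  \<open>K\<close>, and the moves may use all of \<open>E\<close>. So the property can be applied
  locally, within a larger configuration.\<close>

definition interchangeable :: "'b set \<Rightarrow> 'a rel \<Rightarrow> nat \<Rightarrow> 'a set \<Rightarrow> bool" where
  "interchangeable I E k K \<longleftrightarrow>
    (\<forall>S. inj_on S I \<longrightarrow> k \<le> card (K - S ` I) \<longrightarrow>
         (\<forall>i\<in>I. \<forall>j\<in>I. S i \<in> K \<longrightarrow> S j \<in> K \<longrightarrow> exch I E S i j))"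

definition connected_in :: "'a rel \<Rightarrow> 'a set \<Rightarrow> bool" where
  "connected_in E K \<longleftrightarrow> (\<forall>x\<in>K. \<forall>y\<in>K. (x, y) \<in> (Restr E K)\<^sup>*)"

lemma slideI: "i \<in> I \<Longrightarrow> (S i, v) \<in> E \<Longrightarrow> v \<notin> S ` I \<Longrightarrow> slide I E S (S(i := v))"
  unfolding slide_def by blast

lemma slide_inj: "slide I E S S' \<Longrightarrow> inj_on S I \<Longrightarrow> inj_on S' I"
  unfolding slide_def by (auto intro: inj_on_fun_updI)

lemma slide_sym:
  assumes "sym E" "inj_on S I" "slide I E S S'"
  shows "slide I E S' S"
proof -
  obtain i v where i: "i \<in> I" "(S i, v) \<in> E" "v \<notin> S ` I" "S' = S(i := v)"
    using assms(3) unfolding slide_def by blast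
  have "S i \<notin> S' ` I" using i assms(2) by (auto simp: inj_on_def image_iff split: if_splits)
  moreover have "(S' i, S i) \<in> E" using i assms(1) by (auto dest: symD)
  moreover have "S = S'(i := S i)" using i by auto
  ultimately show ?thesis unfolding slide_def using i(1) by blast
qed

text \<open>Moves ignore names: after renaming by \<open>\<pi>\<close>, the same step is made by the
  pebble \<open>inv \<pi> i\<close>.\<close>

lemma slide_relabel:
  assumes "\<pi> permutes I" "slide I E S S'"
  shows "slide I E (S \<circ> \<pi>) (S' \<circ> \<pi>)"
proof -
  obtain i v where i: "i \<in> I" "(S i, v) \<in> E" "v \<notin> S ` I" "S' = S(i := v)"
    using assms(2) unfolding slide_def by blast
  let ?j = "inv \<pi> i"
  have j: "?j \<in> I" "\<pi> ?j = i"
    using assms(1) i(1) by (simp_all add: permutes_inverses permutes_in_image[OF permutes_inv])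
  have "(S \<circ> \<pi>) ` I = S ` I" using assms(1) by (metis image_comp permutes_image)
  moreover have "S' \<circ> \<pi> = (S \<circ> \<pi>)(?j := v)"
    using i(4) j permutes_inverses(2)[OF assms(1)] by (auto simp: fun_eq_iff)
  ultimately show ?thesis unfolding slide_def using i j by (intro bexI[of _ ?j]) auto
qed

lemma reach_refl [simp]: "reach I E S S"
  unfolding reach_def by simp

lemma reach_trans [trans]: "reach I E S S' \<Longrightarrow> reach I E S' S'' \<Longrightarrow> reach I E S S''"
  unfolding reach_def by simp

lemma slide_reach: "slide I E S S' \<Longrightarrow> reach I E S S'"
  unfolding reach_def by simp

lemma reach_inj: "reach I E S S' \<Longrightarrow> inj_on S I \<Longrightarrow> inj_on S' I"
  unfolding reach_def by (induction rule: rtranclp_induct) (auto intro: slide_inj)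

lemma reach_sym:
  assumes "sym E" "inj_on S I" "reach I E S S'"
  shows "reach I E S' S"
  using assms(3) unfolding reach_def
proof (induction rule: rtranclp_induct)
  case (step S1 S2)
  then have "inj_on S1 I" using reach_inj assms(2) unfolding reach_def by blast
  then show ?case using slide_sym[OF assms(1)] step by (meson converse_rtranclp_into_rtranclp)
qed simp

lemma reach_relabel:
  assumes "\<pi> permutes I" "reach I E S S'"
  shows "reach I E (S \<circ> \<pi>) (S' \<circ> \<pi>)"
  using assms(2) unfolding reach_def
proof (induction rule: rtranclp_induct)
  case (step S1 S2)
  then show ?case using slide_relabel[OF assms(1)] by (meson rtranclp.rtrancl_into_rtrancl)
qed simp

lemma reach_mono: "E \<subseteq> F \<Longrightarrow> reach I E S S' \<Longrightarrow> reach I F S S'"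
  unfolding reach_def by (erule rtranclp_mono[THEN predicate2D, rotated]) (fastforce simp: slide_def)

text \<open>Both ends of an edge of \<open>Restr E K\<close> lie in \<open>K\<close>, so no pebble
  crosses the border of \<open>K\<close>.\<close>

lemma reach_Restr:
  assumes "reach I (Restr E K) S S'"
  shows "(S' i \<in> K \<longleftrightarrow> S i \<in> K) \<and> (S i \<notin> K \<longrightarrow> S' i = S i)"
  using assms unfolding reach_def
  by (induction rule: rtranclp_induct) (auto simp: slide_def split: if_splits)

lemma exch_refl [simp]: "exch I E S i i"
  unfolding exch_def by simp

lemma exch_sym: "exch I E S i j \<Longrightarrow> exch I E S j i"
  unfolding exch_def by (simp add: transpose_commute)

text \<open>The transposition of \<open>i\<close> and \<open>k\<close> is that of \<open>j\<close>
  and \<open>k\<close> conjugated by that of \<open>i\<close> and \<open>j\<close>. Each of the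
  three factors is a relabelled copy of one of the two given walks.\<close>

lemma exch_trans:
  assumes "i \<in> I" "j \<in> I" "k \<in> I" "exch I E S i j" "exch I E S j k"
  shows "exch I E S i k"
proof (cases "i = j \<or> j = k \<or> i = k")
  case True
  then show ?thesis using assms by auto
next
  case False
  let ?a = "transpose i j" and ?b = "transpose j k"
  have p: "?a permutes I" "?b permutes I" using assms by (auto intro: permutes_swap_id)
  have "reach I E S (S \<circ> ?a)" using assms unfolding exch_def by blast
  also have "reach I E (S \<circ> ?a) (S \<circ> ?b \<circ> ?a)"
    using reach_relabel[OF p(1)] assms(5) unfolding exch_def by blast
  also have "reach I E (S \<circ> ?b \<circ> ?a) (S \<circ> ?a \<circ> (?b \<circ> ?a))"
    using reach_relabel[OF permutes_compose[OF p], of E S "S \<circ> ?a"] assms(4) unfolding exch_def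
    by (simp add: comp_assoc)
  also have "S \<circ> ?a \<circ> (?b \<circ> ?a) = S \<circ> transpose i k"
    using False by (auto simp: fun_eq_iff transpose_def)
  finally show ?thesis unfolding exch_def .
qed

text \<open>Go to \<open>S'\<close>, swap there, and return along the reversed walk with
  \<open>i\<close> and \<open>j\<close> renamed. This allows any configuration to be brought into a
  convenient form before pebbles are swapped.\<close>

lemma exch_reach:
  assumes "sym E" "inj_on S I" "reach I E S S'" "i \<in> I" "j \<in> I" "exch I E S' i j"
  shows "exch I E S i j"
proof -
  have "transpose i j permutes I" using assms by (auto intro: permutes_swap_id)
  then have "reach I E (S' \<circ> transpose i j) (S \<circ> transpose i j)"
    using reach_relabel reach_sym assms by blast
  then show ?thesis using assms unfolding exch_def by (meson reach_trans)
qed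

text \<open>Permutations of a finite set are products of transpositions, and a swap possible at
  \<open>S\<close> is possible at \<open>S \<circ> p\<close> after relabelling by
  \<open>p\<close>.\<close>

lemma reach_permuted:
  assumes "finite I" "\<And>i j. i \<in> I \<Longrightarrow> j \<in> I \<Longrightarrow> exch I E S i j" "\<pi> permutes I"
  shows "reach I E S (S \<circ> \<pi>)"
  using assms(3,1)
proof (induction rule: permutes_induct)
  case (swap a b p)
  have "reach I E (S \<circ> p) (S \<circ> transpose a b \<circ> p)"
    using reach_relabel[OF swap(4)] assms(2)[OF swap(1,2)] unfolding exch_def by blast
  then show ?case using swap by (metis comp_assoc reach_trans)
qed simp

section \<open>Moving holes through connected sets\<close>

lemma slide_image:
  assumes "inj_on S I" "i \<in> I"
  shows "(S(i := v)) ` I = insert v (S ` I - {S i})"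
  using assms by (auto simp: inj_on_def)

text \<open>The hole wanders from \<open>t\<close> to \<open>u\<close> while the pebbles on the way
  step back one by one. Only the occupied set is tracked; which pebble ends where is left
  open.\<close>

lemma reach_transfer_hole:
  assumes "(t, u) \<in> E\<^sup>*" "sym E" "inj_on S I" "t \<notin> S ` I" "u \<in> S ` I"
  shows "\<exists>S'. reach I E S S' \<and> S' ` I = insert t (S ` I - {u})"
  using assms(1,3-)
proof (induction arbitrary: S rule: converse_rtrancl_induct)
  case (step t x)
  have xt: "(x, t) \<in> E" using step(1) assms(2) by (auto dest: symD)
  show ?case
  proof (cases "x \<in> S ` I")
    case True
    then obtain i where i: "i \<in> I" "S i = x" by auto
    let ?S = "S(i := t)"
    have s: "slide I E S ?S" using slideI[of i I S t E] i xt step by auto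
    have im: "?S ` I = insert t (S ` I - {x})" using slide_image[of S I i t] step i by auto
    show ?thesis
    proof (cases "x = u")
      case True
      then show ?thesis using s im slide_reach by blast
    next
      case False
      have "x \<notin> ?S ` I" using im step True by auto
      moreover have "u \<in> ?S ` I" using im step False by auto
      ultimately obtain S' where S': "reach I E ?S S'" "S' ` I = insert x (?S ` I - {u})"
        using step(3)[of ?S] slide_inj[OF s] step by blast
      have "S' ` I = insert t (S ` I - {u})"
        unfolding S'(2) im using step(5,6) True False by auto
      then show ?thesis using S'(1) s by (meson slide_reach reach_trans)
    qed
  next
    case False
    \<comment> \<open>As \<open>x\<close> is empty too, its hole is sent to \<open>u\<close> first;
      the pebble that then fills \<open>x\<close> steps on to \<open>t\<close>.\<close>
    then obtain S' where S': "reach I E S S'" "S' ` I = insert x (S ` I - {u})"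
      using step by blast
    have inj: "inj_on S' I" using reach_inj[OF S'(1) step(4)] .
    show ?thesis
    proof (cases "t = x")
      case True
      then show ?thesis using S' by blast
    next
      case ne: False
      obtain i where i: "i \<in> I" "S' i = x" using S'(2) by (metis imageE insertI1)
      have s: "slide I E S' (S'(i := t))" using slideI[of i I S' t E] i xt S'(2) ne step by auto
      have "(S'(i := t)) ` I = insert t (S ` I - {u})"
        using slide_image[OF inj i(1), of t] i S'(2) False by auto
      then show ?thesis using s S' by (meson slide_reach reach_trans)
    qed
  qed
qed auto

lemma sym_Restr: "sym E \<Longrightarrow> sym (Restr E K)"
  by (auto simp: sym_def)

text \<open>Induction on the number of targets still empty. While a target \<open>t\<close> is
  empty, the equal cardinalities leave some pebble of \<open>K\<close> on a vertex \<open>u\<close>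
  outside \<open>T\<close>, and the hole at \<open>t\<close> is moved to \<open>u\<close>.\<close>

lemma reach_occupied:
  assumes "sym E" "connected_in E K" "finite K" "inj_on S I" "T \<subseteq> K" "card T = card (K \<inter> S ` I)"
  shows "\<exists>S'. reach I (Restr E K) S S' \<and> K \<inter> S' ` I = T"
  using assms(4,6)
proof (induction "card (T - S ` I)" arbitrary: S rule: less_induct)
  case less
  have fT: "finite T" using assms finite_subset by blast
  show ?case
  proof (cases "T \<subseteq> S ` I")
    case True
    then have "T \<subseteq> K \<inter> S ` I" using assms by auto
    then have "K \<inter> S ` I = T" using less(3) assms(3) by (metis card_subset_eq finite_Int)
    then show ?thesis by (intro exI[of _ S]) auto
  next
    case False
    then obtain t where t: "t \<in> T" "t \<notin> S ` I" by auto
    have "\<not> K \<inter> S ` I \<subseteq> T"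
      using t less(3) fT by (metis IntD2 card_subset_eq)
    then obtain u where u: "u \<in> K" "u \<in> S ` I" "u \<notin> T" by auto
    have "(t, u) \<in> (Restr E K)\<^sup>*" using assms t u unfolding connected_in_def by blast
    then obtain S1 where S1: "reach I (Restr E K) S S1" "S1 ` I = insert t (S ` I - {u})"
      using reach_transfer_hole[OF _ sym_Restr[OF assms(1)] less(2)] t u by blast
    have tK: "t \<in> K" using t assms by auto
    have "K \<inter> S1 ` I = insert t ((K \<inter> S ` I) - {u})" unfolding S1(2) using t u tK by auto
    moreover have "card (K \<inter> S ` I) > 0" using u assms(3) by (auto simp: card_gt_0_iff)
    ultimately have c: "card (K \<inter> S1 ` I) = card (K \<inter> S ` I)"
      using t u assms(3) by simp
    have "T - S1 ` I \<subset> T - S ` I" unfolding S1(2) using t u by auto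
    then have "card (T - S1 ` I) < card (T - S ` I)" using fT by (intro psubset_card_mono) auto
    then obtain S' where "reach I (Restr E K) S1 S'" "K \<inter> S' ` I = T"
      using less(1)[of S1] less(2,3) S1 c reach_inj by fastforce
    then show ?thesis using S1 reach_trans by blast
  qed
qed

text \<open>Used to park holes on \<open>A\<close> and unspecified pebbles on \<open>B\<close>: any
  set between \<open>B\<close> and \<open>K - A\<close> with as many vertices as there are pebbles
  in \<open>K\<close> can be made the occupied set.\<close>

lemma rearrange:
  assumes "sym E" "connected_in E K" "finite K" "inj_on S I"
    and "A \<subseteq> K" "B \<subseteq> K" "A \<inter> B = {}" "card A \<le> card (K - S ` I)" "card B \<le> card (K \<inter> S ` I)"
  obtains S' where "reach I E S S'" "inj_on S' I" "A \<inter> S' ` I = {}" "B \<subseteq> S' ` I"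
    "\<And>i. S' i \<in> K \<longleftrightarrow> S i \<in> K" "\<And>i. S i \<notin> K \<Longrightarrow> S' i = S i"
proof -
  have fA: "finite A" using assms finite_subset by blast
  have "card K = card (K \<inter> S ` I) + card (K - S ` I)"
    using card_Int_Diff[OF assms(3)] .
  then have "card (K \<inter> S ` I) \<le> card (K - A)"
    using assms(5,8) fA by (simp add: card_Diff_subset)
  then obtain T where T: "B \<subseteq> T" "T \<subseteq> K - A" "card T = card (K \<inter> S ` I)"
    using exists_subset_between[of B "card (K \<inter> S ` I)" "K - A"] assms by blast
  then obtain S' where S': "reach I (Restr E K) S S'" "K \<inter> S' ` I = T"
    using reach_occupied[OF assms(1-4), of T] by blast
  show thesis
  proof
    show "reach I E S S'" using S'(1) by (rule reach_mono[rotated]) auto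
    show "inj_on S' I" using S' reach_inj assms by blast
    show "A \<inter> S' ` I = {}" "B \<subseteq> S' ` I" using S'(2) T assms by auto
    show "\<And>i. S' i \<in> K \<longleftrightarrow> S i \<in> K" "\<And>i. S i \<notin> K \<Longrightarrow> S' i = S i"
      using reach_Restr[OF S'(1)] by auto
  qed
qed

section \<open>Cycles with a pendant edge\<close>

text \<open>A cycle of length \<open>m\<close> is a periodic sequence, so that no index arithmetic modulo \<open>m\<close> is needed.\<close>

definition cyc :: "'a rel \<Rightarrow> nat \<Rightarrow> (nat \<Rightarrow> 'a) \<Rightarrow> bool" where
  "cyc E m z \<longleftrightarrow> 3 \<le> m \<and> inj_on z {..<m} \<and> (\<forall>i. z (i + m) = z i) \<and> (\<forall>i. (z i, z (Suc i)) \<in> E)"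

lemma cycD:
  assumes "cyc E m z"
  shows "3 \<le> m" "inj_on z {..<m}" "z (i + m) = z i" "(z i, z (Suc i)) \<in> E"
  using assms unfolding cyc_def by auto

lemma cyc_periodic: "cyc E m z \<Longrightarrow> z (i + m * j) = z i"
proof (induction j)
  case (Suc j)
  then show ?case using cycD(3)[of E m z "i + m * j"] by (simp add: algebra_simps)
qed simp

lemma cyc_eq_iff:
  assumes "cyc E m z"
  shows "z i = z j \<longleftrightarrow> i mod m = j mod m"
proof -
  have "z k = z (k mod m)" for k
    using cyc_periodic[OF assms, of "k mod m" "k div m"] by simp
  then show ?thesis
    using inj_onD[OF cycD(2)[OF assms], of "i mod m" "j mod m"] cycD(1)[OF assms]
    by (metis lessThan_iff mod_less_divisor numeral_3_eq_3 less_le_trans zero_less_Suc)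
qed

lemma cyc_shift:
  assumes "cyc E m z"
  shows "cyc E m (\<lambda>i. z (i + h))"
proof -
  have "inj_on (\<lambda>i. z (i + h)) {..<m}"
  proof (rule linorder_inj_onI')
    fix a b assume ab: "a \<in> {..<m}" "b \<in> {..<m}" "a < b"
    have "\<not> m dvd b - a" using ab by (auto dest: dvd_imp_le)
    then show "z (a + h) \<noteq> z (b + h)"
      unfolding cyc_eq_iff[OF assms] using ab mod_eq_dvd_iff_nat[of "a + h" "b + h" m] by auto
  qed
  moreover have "z (i + m + h) = z (i + h)" for i
    using cycD(3)[OF assms, of "i + h"] by (simp add: algebra_simps)
  ultimately show ?thesis using cycD[OF assms] unfolding cyc_def by simp
qed

lemma range_cyc: "cyc E m z \<Longrightarrow> range z = z ` {..<m}"
proof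
  assume c: "cyc E m z"
  show "range z \<subseteq> z ` {..<m}"
  proof
    fix x assume "x \<in> range z"
    then obtain i where "x = z i" by auto
    then have "x = z (i mod m)" using cyc_eq_iff[OF c] by simp
    moreover have "i mod m < m" using cycD(1)[OF c] by simp
    ultimately show "x \<in> z ` {..<m}" by blast
  qed
qed auto

lemma finite_range_cyc: "cyc E m z \<Longrightarrow> finite (range z)"
  by (simp add: range_cyc)

lemma card_range_cyc: "cyc E m z \<Longrightarrow> card (range z) = m"
  using range_cyc card_image cycD(2) by (metis card_lessThan)

section \<open>Connected vertex sets\<close>

lemma path_connected_in:
  assumes "sym E" "\<And>l. a \<le> l \<Longrightarrow> l < b \<Longrightarrow> (z l, z (Suc l)) \<in> E"
  shows "connected_in E (z ` {a..b::nat})"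
proof -
  let ?R = "Restr E (z ` {a..b})"
  have up: "(z a, z l) \<in> ?R\<^sup>*" if "a \<le> l" "l \<le> b" for l
    using that
  proof (induction l rule: dec_induct)
    case (step l)
    then have "(z l, z (Suc l)) \<in> ?R" using assms(2) by auto
    then show ?case using step by (meson Suc_leD rtrancl.rtrancl_into_rtrancl)
  qed simp
  have "sym (?R\<^sup>*)" using assms(1) by (simp add: sym_Restr sym_rtrancl)
  then have "(z l, z a) \<in> ?R\<^sup>*" if "a \<le> l" "l \<le> b" for l
    using up[OF that] by (auto dest: symD)
  then have "(z l, z l') \<in> ?R\<^sup>*" if "a \<le> l" "l \<le> b" "a \<le> l'" "l' \<le> b" for l l'
    using up[of l'] that by (meson rtrancl_trans)
  then show ?thesis unfolding connected_in_def by auto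
qed

lemma connected_in_cyc:
  assumes "sym E" "cyc E m z"
  shows "connected_in E (range z)"
proof -
  have "{..<m} = {0..m - 1}" using cycD(1)[OF assms(2)] by auto
  then have "range z = z ` {0..m - 1}" using range_cyc[OF assms(2)] by simp
  then show ?thesis using path_connected_in[OF assms(1)] cycD(4)[OF assms(2)] by metis
qed

lemma connected_in_Un:
  assumes "sym E" "connected_in E K" "connected_in E L" "x \<in> K" "y \<in> L" "x = y \<or> (x, y) \<in> E"
  shows "connected_in E (K \<union> L)"
proof -
  let ?R = "Restr E (K \<union> L)"
  have m: "(Restr E K)\<^sup>* \<subseteq> ?R\<^sup>*" "(Restr E L)\<^sup>* \<subseteq> ?R\<^sup>*" by (rule rtrancl_mono, blast)+
  have s: "sym (?R\<^sup>*)" using assms(1) by (simp add: sym_Restr sym_rtrancl)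
  have xy: "(x, y) \<in> ?R\<^sup>*" using assms(4-6) by blast
  have "(x, k) \<in> ?R\<^sup>*" if "k \<in> K \<union> L" for k
  proof (cases "k \<in> K")
    case True
    then show ?thesis using assms(2,4) m unfolding connected_in_def by blast
  next
    case False
    then have "(y, k) \<in> ?R\<^sup>*" using that assms(3,5) m unfolding connected_in_def by blast
    then show ?thesis using xy by simp
  qed
  then show ?thesis unfolding connected_in_def using s by (meson rtrancl_trans symD)
qed

lemma connected_in_insert:
  assumes "sym E" "connected_in E K" "x \<in> K" "(x, w) \<in> E"
  shows "connected_in E (insert w K)"
  using connected_in_Un[OF assms(1,2), of "{w}" x w] assms(3,4) by (auto simp: connected_in_def)

lemma connected_in_boundary:
  assumes "connected_in E K" "A \<subseteq> K" "A \<noteq> {}" "A \<noteq> K"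
  obtains x y where "x \<in> A" "y \<in> K - A" "(x, y) \<in> E"
proof -
  obtain a b where ab: "a \<in> A" "b \<in> K" "b \<notin> A" using assms by blast
  then have "(a, b) \<in> (Restr E K)\<^sup>*" using assms unfolding connected_in_def by blast
  then have "\<exists>x y. x \<in> A \<and> y \<in> K - A \<and> (x, y) \<in> E" using ab(1,3)
    by (induction rule: converse_rtrancl_induct) auto
  then show thesis using that by blast
qed

text \<open>Shunting at a vertex \<open>c\<close> with three neighbours: \<open>i\<close> withdraws
  to \<open>b\<close>, \<open>j\<close> passes through \<open>c\<close> to \<open>d\<close>,
  \<open>i\<close> passes through \<open>c\<close> to \<open>a\<close>, and \<open>j\<close> steps
  back to \<open>c\<close>.\<close>

lemma star_exch:
  assumes "inj_on S I" "sym E" "i \<in> I" "j \<in> I" "S i = c" "S j = a" "b \<notin> S ` I" "d \<notin> S ` I"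
    and "(c, a) \<in> E" "(c, b) \<in> E" "(c, d) \<in> E" "b \<noteq> d" "a \<noteq> c"
  shows "exch I E S i j"
proof -
  have ij: "i \<noteq> j" using assms by auto
  have o: "\<And>k. k \<in> I \<Longrightarrow> k \<noteq> i \<Longrightarrow> c \<noteq> S k" "\<And>k. k \<in> I \<Longrightarrow> k \<noteq> j \<Longrightarrow> a \<noteq> S k"
    using assms(1,3-6) by (auto simp: inj_on_def)
  have e: "(a, c) \<in> E" "(b, c) \<in> E" "(d, c) \<in> E" using assms by (auto dest: symD)
  note [simp] = ij ij[symmetric] assms(3-6)
  have bd: "S k \<noteq> b" "S k \<noteq> d" if "k \<in> I" for k using assms(7,8) that by auto
  have ne: "b \<noteq> c" "b \<noteq> a" "d \<noteq> c" "d \<noteq> a" using bd[of i] bd[of j] by auto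
  let ?S1 = "S(i := b)"
  let ?S2 = "?S1(j := c)"
  let ?S3 = "?S2(j := d)"
  let ?S4 = "?S3(i := c)"
  let ?S5 = "?S4(i := a)"
  let ?S6 = "?S5(j := c)"
  have "slide I E S ?S1" using assms by (intro slideI) auto
  moreover have "slide I E ?S1 ?S2" using assms e ne o by (intro slideI) (auto simp: image_iff)
  moreover have "slide I E ?S2 ?S3" using assms ne o bd by (intro slideI) (auto simp: image_iff)
  moreover have "slide I E ?S3 ?S4" using e ne o bd by (intro slideI) (auto simp: image_iff)
  moreover have "slide I E ?S4 ?S5" using assms ne o bd by (intro slideI) (auto simp: image_iff)
  moreover have "slide I E ?S5 ?S6" using assms e ne o bd by (intro slideI) (auto simp: image_iff)
  ultimately have "reach I E S ?S6" by (meson slide_reach reach_trans)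
  moreover have "?S6 = S \<circ> transpose i j" by (auto simp: fun_eq_iff transpose_def)
  ultimately show ?thesis unfolding exch_def by simp
qed

text \<open>The hole travels from \<open>z 0\<close> to \<open>z n\<close>, and each pebble it meets
  steps back by one. Because \<open>n < m\<close>, the hole does not come round again and no pebble
  is shifted twice.\<close>

lemma cyc_rotate_aux:
  assumes "cyc E m z" "sym E" "inj_on S I" "z 0 \<notin> S ` I" "n < m"
  shows "\<exists>S'. reach I E S S' \<and> z n \<notin> S' ` I \<and>
    (\<forall>i\<in>I. (\<forall>l<n. S i = z (Suc l) \<longrightarrow> S' i = z l) \<and> ((\<forall>l<n. S i \<noteq> z (Suc l)) \<longrightarrow> S' i = S i))"
  using assms(5)
proof (induction n)
  case 0
  then show ?case using assms(4) by (intro exI[of _ S]) auto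
next
  case (Suc n)
  then obtain S1 where S1: "reach I E S S1" "z n \<notin> S1 ` I"
    and a: "\<And>i l. i \<in> I \<Longrightarrow> l < n \<Longrightarrow> S i = z (Suc l) \<Longrightarrow> S1 i = z l"
    and b: "\<And>i. i \<in> I \<Longrightarrow> (\<forall>l<n. S i \<noteq> z (Suc l)) \<Longrightarrow> S1 i = S i" by auto
  have zz: "z k = z l \<longleftrightarrow> k = l" if "k \<le> Suc n" "l \<le> Suc n" for k l
    using cyc_eq_iff[OF assms(1), of k l] Suc.prems that by simp
  have inj: "inj_on S1 I" using reach_inj[OF S1(1) assms(3)] .
  \<comment> \<open>The first \<open>n\<close> steps neither bring a pebble to
    \<open>z (Suc n)\<close> nor take one away.\<close>
  have key: "S1 i = z (Suc n) \<longleftrightarrow> S i = z (Suc n)" if "i \<in> I" for i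
  proof (cases "\<forall>l<n. S i \<noteq> z (Suc l)")
    case True
    then show ?thesis using b that by simp
  next
    case False
    then obtain l where "l < n" "S i = z (Suc l)" by auto
    then show ?thesis using a[OF that, of l] zz by simp
  qed
  show ?case
  proof (cases "z (Suc n) \<in> S1 ` I")
    case False
    then have "\<forall>i\<in>I. S i \<noteq> z (Suc n)" using key by (metis imageI)
    then show ?thesis using S1(1) False a b by (intro exI[of _ S1]) (auto simp: less_Suc_eq)
  next
    case True
    then obtain j where j: "j \<in> I" "S1 j = z (Suc n)" by auto
    let ?S = "S1(j := z n)"
    have "slide I E S1 ?S"
      using j S1(2) cycD(4)[OF assms(1), of n] assms(2) by (intro slideI) (auto dest: symD)
    then have "reach I E S ?S" using S1(1) by (meson slide_reach reach_trans)
    moreover have "z (Suc n) \<notin> ?S ` I"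
      using slide_image[OF inj j(1), of "z n"] j(2) zz[of n "Suc n"] by auto
    moreover have "(\<forall>l<Suc n. S i = z (Suc l) \<longrightarrow> ?S i = z l) \<and> 
      ((\<forall>l<Suc n. S i \<noteq> z (Suc l)) \<longrightarrow> ?S i = S i)" if "i \<in> I" for i
    proof (cases "i = j")
      case True
      then have "S i = z (Suc n)" using key j by simp
      then show ?thesis using True zz by auto
    next
      case False
      then have "S i \<noteq> z (Suc n)" using key[OF that] j inj that by (metis inj_onD)
      then show ?thesis using False a[OF that] b[OF that] by (auto simp: less_Suc_eq)
    qed
    ultimately show ?thesis by blast
  qed
qed

text \<open>With the indices counted from the hole, \<open>m - 1\<close> steps of the hole shift
  every pebble of the cycle back by exactly one.\<close>

lemma cyc_rotate:
  assumes "cyc E m z" "sym E" "inj_on S I" "z h \<notin> S ` I"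
  shows "\<exists>S'. reach I E S S' \<and> (\<exists>h. z h \<notin> S' ` I) \<and> (\<forall>i\<in>I. \<forall>k. S i = z (Suc k) \<longrightarrow> S' i = z k) \<and>
    (\<forall>i\<in>I. S i \<notin> range z \<longrightarrow> S' i = S i)"
proof -
  let ?z = "\<lambda>i. z (i + h)"
  have c: "cyc E m ?z" by (rule cyc_shift[OF assms(1)])
  have m: "3 \<le> m" using cycD(1)[OF assms(1)] .
  obtain S' where S': "reach I E S S'" "?z (m - 1) \<notin> S' ` I"
    and a: "\<And>i l. i \<in> I \<Longrightarrow> l < m - 1 \<Longrightarrow> S i = ?z (Suc l) \<Longrightarrow> S' i = ?z l"
    and b: "\<And>i. i \<in> I \<Longrightarrow> (\<forall>l<m - 1. S i \<noteq> ?z (Suc l)) \<Longrightarrow> S' i = S i"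
    using cyc_rotate_aux[OF c assms(2,3), of "m - 1"] assms(4) m by auto
  have "S' i = z k" if i: "i \<in> I" "S i = z (Suc k)" for i k
  proof -
    \<comment> \<open>The index of \<open>z k\<close> counted from the hole \<open>z h\<close>:
      modulo \<open>m\<close>, adding \<open>(m - 1) * h\<close> is subtracting \<open>h\<close>. It
      is not \<open>m - 1\<close>, since \<open>z (Suc k)\<close> would then be the hole.\<close>
    define l where "l = (k + (m - 1) * h) mod m"
    have eq: "(m - 1) * h + h = m * h" using m by (cases m) auto
    have "?z (Suc l) = ?z (Suc (k + (m - 1) * h))"
      unfolding cyc_eq_iff[OF c] l_def by (simp add: mod_Suc_eq)
    also have "\<dots> = z (Suc k)" using cyc_periodic[OF assms(1), of "Suc k" h] eq by (simp add: add.assoc)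
    finally have 1: "?z (Suc l) = z (Suc k)" .
    have "?z l = ?z (k + (m - 1) * h)" unfolding cyc_eq_iff[OF c] l_def by simp
    also have "\<dots> = z k" using cyc_periodic[OF assms(1), of k h] eq by (simp add: add.assoc)
    finally have 2: "?z l = z k" .
    have "l < m" unfolding l_def using m by simp
    moreover have "l \<noteq> m - 1"
    proof
      assume "l = m - 1"
      then have "?z (Suc l) = z h" using cycD(3)[OF assms(1), of h] m by (simp add: add.commute)
      then show False using 1 i assms(4) by (metis imageI)
    qed
    ultimately show ?thesis using a[OF i(1), of l] 1 2 i(2) by simp
  qed
  moreover have "S' i = S i" if "i \<in> I" "S i \<notin> range z" for i
    using b[OF that(1)] that(2) by (metis rangeI)
  ultimately show ?thesis using S' by blast
qed

text \<open>At the junction \<open>z 0\<close> the neighbours \<open>z 1\<close>, \<open>w\<close>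
  and \<open>z (m - 1)\<close> form the star of \<open>star_exch\<close>. The hole
  \<open>z h\<close> is brought to \<open>z (m - 1)\<close> along the arc that avoids
  \<open>z 0\<close> and \<open>z 1\<close>, so the two pebbles stay in place meanwhile.\<close>

lemma lollipop_exch_base:
  assumes "cyc E m z" "sym E" "w \<notin> range z" "(z 0, w) \<in> E"
    and "inj_on S I" "w \<notin> S ` I" "z h \<notin> S ` I" "i \<in> I" "j \<in> I" "S i = z 0" "S j = z 1"
  shows "exch I E S i j"
proof -
  have m: "3 \<le> m" using cycD(1)[OF assms(1)] .
  define h' where "h' = h mod m"
  have h': "h' < m" "z h' \<notin> S ` I" using assms(7) cyc_eq_iff[OF assms(1), of h' h] m by (auto simp: h'_def)
  then have h2: "2 \<le> h'" using assms(8-11) by (metis One_nat_def imageI less_2_cases not_le_imp_less)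
  let ?K = "z ` {h'..m - 1}"
  have "z c \<notin> ?K" if "c < 2" for c
  proof
    assume "z c \<in> ?K"
    then obtain l where "h' \<le> l" "l \<le> m - 1" "z c = z l" by auto
    then show False using cyc_eq_iff[OF assms(1), of c l] that h2 m by simp
  qed
  then have z01: "z 0 \<notin> ?K" "z 1 \<notin> ?K" by simp_all
  have "\<exists>S'. reach I (Restr E ?K) S S' \<and> z (m - 1) \<notin> S' ` I \<and> w \<notin> S' ` I"
  proof (cases "z (m - 1) \<in> S ` I")
    case True
    have "connected_in E ?K" by (rule path_connected_in) (use assms cycD(4) in auto)
    then have "(z h', z (m - 1)) \<in> (Restr E ?K)\<^sup>*" using h' unfolding connected_in_def by auto
    then obtain S' where "reach I (Restr E ?K) S S'" "S' ` I = insert (z h') (S ` I - {z (m - 1)})"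
      using reach_transfer_hole[OF _ sym_Restr[OF assms(2)] assms(5)] h'(2) True by blast
    moreover have "z (m - 1) \<noteq> z h'" using True h' by metis
    moreover have "w \<noteq> z h'" using assms(3) by auto
    ultimately show ?thesis using assms(6) by (intro exI[of _ S']) auto
  qed (use assms(6) in \<open>auto intro: exI[of _ S]\<close>)
  then obtain S' where S': "reach I (Restr E ?K) S S'" "z (m - 1) \<notin> S' ` I" "w \<notin> S' ` I" by blast
  have "S' i = z 0" "S' j = z 1" using reach_Restr[OF S'(1)] z01 assms(10,11) by metis+
  moreover have "reach I E S S'" using S'(1) by (rule reach_mono[rotated]) auto
  moreover have "(z 0, z (m - 1)) \<in> E"
    using cycD(4)[OF assms(1), of "m - 1"] cycD(3)[OF assms(1), of 0] m assms(2) by (auto dest: symD)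
  moreover have "z 1 \<noteq> z 0" using cyc_eq_iff[OF assms(1), of 1 0] m by auto
  moreover have "(z 0, z 1) \<in> E" using cycD(4)[OF assms(1), of 0] by simp
  ultimately show ?thesis
    using star_exch[of S' I E i j "z 0" "z 1" w "z (m - 1)"] exch_reach[of E S I S' i j] S'(2,3)
      assms reach_inj[of I E S S'] by blast
qed

text \<open>Rotating the cycle by one step takes the neighbouring pair one place closer to the
  junction and keeps \<open>w\<close> empty.\<close>

lemma lollipop_exch_adjacent:
  assumes "cyc E m z" "sym E" "w \<notin> range z" "(z 0, w) \<in> E"
    and "inj_on S I" "w \<notin> S ` I" "z h \<notin> S ` I" "i \<in> I" "j \<in> I" "S i = z a" "S j = z (Suc a)"
  shows "exch I E S i j"
  using assms(5-)
proof (induction a arbitrary: S h)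
  case 0
  then show ?case using lollipop_exch_base[OF assms(1-4)] by simp
next
  case (Suc a)
  obtain S' h' where S': "reach I E S S'" "z h' \<notin> S' ` I"
    and a: "\<And>i k. i \<in> I \<Longrightarrow> S i = z (Suc k) \<Longrightarrow> S' i = z k"
    and b: "\<And>i. i \<in> I \<Longrightarrow> S i \<notin> range z \<Longrightarrow> S' i = S i"
    using cyc_rotate[OF assms(1,2) Suc(2,4)] by blast
  have "w \<noteq> S' k" if "k \<in> I" for k
  proof (cases "S k \<in> range z")
    case True
    then obtain l where "S k = z l" by auto
    \<comment> \<open>One full turn is added so that \<open>z l\<close> gets a successor index even
      for \<open>l = 0\<close>.\<close>
    also have "z l = z (Suc (l + m - 1))"
      using cycD(3)[OF assms(1), of l] cycD(1)[OF assms(1)] by simp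
    finally show ?thesis using a[OF that] assms(3) by auto
  next
    case False
    then show ?thesis using b[OF that] Suc(3) that by auto
  qed
  then have "exch I E S' i j" using Suc.IH[of S' h'] S' a Suc reach_inj by blast
  then show ?case using exch_reach[OF assms(2) Suc(2) S'(1)] Suc by blast
qed

text \<open>Walk from \<open>i\<close> towards \<open>j\<close>: a pebble \<open>k\<close> on the
  next vertex is exchangeable with \<open>i\<close> and, by induction, with \<open>j\<close>; if
  that vertex is empty, \<open>i\<close> itself moves there.\<close>

lemma lollipop_exch_distance:
  assumes "cyc E m z" "sym E" "w \<notin> range z" "(z 0, w) \<in> E"
    and "inj_on S I" "w \<notin> S ` I" "z h \<notin> S ` I" "i \<in> I" "j \<in> I" "S i = z a" "S j = z (a + d)"
  shows "exch I E S i j"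
  using assms(5-)
proof (induction d arbitrary: S h i a)
  case 0
  then have "i = j" by (metis add_0_right inj_onD)
  then show ?case by simp
next
  case (Suc d)
  show ?case
  proof (cases "z (Suc a) \<in> S ` I")
    case True
    then obtain k where k: "k \<in> I" "S k = z (Suc a)" by auto
    have "exch I E S i k" using lollipop_exch_adjacent[OF assms(1-4) Suc(2-5) k(1) Suc(7) k(2)] .
    moreover have "exch I E S k j" using Suc.IH[OF Suc(2-4) k(1) Suc(6) k(2)] Suc(8) by simp
    ultimately show ?thesis using exch_trans Suc(5,6) k(1) by metis
  next
    case False
    show ?thesis
    proof (cases "i = j")
      \<comment> \<open>Distances may wrap around the cycle and lead back to \<open>z a\<close>,
        where \<open>j\<close> is \<open>i\<close>; sliding \<open>i\<close> would then move
        \<open>j\<close> as well.\<close>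
      case ne: False
      let ?S = "S(i := z (Suc a))"
      have s: "slide I E S ?S" using Suc(5,7) False cycD(4)[OF assms(1)] by (intro slideI) auto
      have im: "?S ` I = insert (z (Suc a)) (S ` I - {z a})"
        using slide_image[OF Suc(2,5)] Suc(7) by simp
      have za: "z a \<notin> ?S ` I" using im False Suc(5,7) by (metis DiffE imageI insertE singletonI)
      have w: "w \<notin> ?S ` I" using im Suc(3) assms(3) by auto
      have "exch I E ?S i j"
        by (rule Suc.IH[OF slide_inj[OF s Suc(2)] w za Suc(5,6), of "Suc a"]) (use ne Suc(8) in auto)
      then show ?thesis using exch_reach[OF assms(2) Suc(2) slide_reach[OF s]] Suc(5,6) by blast
    qed simp
  qed
qed

text \<open>Parking the two holes on the pendant vertex \<open>w\<close> and the junction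
  \<open>x\<close> forces all remaining pebbles of the set onto the cycle, which is then indexed
  from \<open>x\<close>.\<close>

lemma interchangeable_lollipop:
  assumes "cyc E m z" "sym E" "w \<notin> range z" "x \<in> range z" "(x, w) \<in> E"
  shows "interchangeable I E 2 (insert w (range z))"
  unfolding interchangeable_def
proof (intro allI impI ballI)
  fix S i j
  assume S: "inj_on S I" "2 \<le> card (insert w (range z) - S ` I)"
    and ij: "i \<in> I" "j \<in> I" "S i \<in> insert w (range z)" "S j \<in> insert w (range z)"
  let ?L = "insert w (range z)"
  obtain c where c: "x = z c" using assms(4) by auto
  let ?z = "\<lambda>i. z (i + c)"
  have cyc: "cyc E m ?z" by (rule cyc_shift[OF assms(1)])
  have "z k \<in> range ?z" for k
  proof
    have "(m - 1) * c + c = m * c" using cycD(1)[OF assms(1)] by (cases m) auto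
    then show "z k = ?z (k + (m - 1) * c)" using cyc_periodic[OF assms(1), of k c] by (simp add: add.assoc)
  qed simp
  then have rz: "range ?z = range z" by auto
  have conn: "connected_in E ?L"
    using connected_in_insert[OF assms(2) connected_in_cyc[OF assms(2,1)] assms(4,5)] .
  have "card {w, x} = 2" using assms(3,4) by (metis card_2_iff)
  then obtain S' where S': "reach I E S S'" "inj_on S' I" "{w, x} \<inter> S' ` I = {}"
      "\<And>i. S' i \<in> ?L \<longleftrightarrow> S i \<in> ?L"
    using rearrange[OF assms(2) conn _ S(1), of "{w, x}" "{}"] S(2) assms(4)
      finite_range_cyc[OF assms(1)] by (metis Int_empty_right card.empty empty_subsetI
        finite_insert insert_subset insertCI zero_le)
  have "S' i \<in> ?L" "S' j \<in> ?L" using S'(4) ij by auto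
  then have "S' i \<in> range ?z" "S' j \<in> range ?z" using S'(3) ij rz by (auto simp: image_iff)
  then obtain a b where ab: "S' i = ?z a" "S' j = ?z b" by blast
  \<comment> \<open>Adding \<open>a\<close> full turns to \<open>b\<close> makes the distance from
    \<open>a\<close> a natural number.\<close>
  have "m * a \<ge> a" using cycD(1)[OF assms(1)] by simp
  then have "a + (b + m * a - a) = b + m * a" by (metis le_add_diff_inverse trans_le_add2)
  then have "S' j = ?z (a + (b + m * a - a))" using ab(2) cyc_periodic[OF cyc, of b a] by metis
  then have "exch I E S' i j"
    using lollipop_exch_distance[OF cyc assms(2), of w S' I 0 i j a] ab assms(3,5) rz c S' ij by auto
  then show "exch I E S i j" using exch_reach[OF assms(2) S(1) S'(1)] ij by blast
qed

section \<open>Enlarging interchangeable sets\<close>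

lemma interchangeable_mono:
  assumes "interchangeable I E k L" "K \<subseteq> L" "k \<le> k'" "finite L"
  shows "interchangeable I E k' K"
proof -
  have "k \<le> card (L - S ` I)" if "k' \<le> card (K - S ` I)" for S
  proof -
    have "card (K - S ` I) \<le> card (L - S ` I)" using assms by (intro card_mono) auto
    then show ?thesis using that assms(3) by simp
  qed
  then show ?thesis using assms(1,2) unfolding interchangeable_def by (meson subsetD)
qed

lemma interchangeableD:
  assumes "interchangeable I E k K" "inj_on S I" "A \<subseteq> K" "A \<inter> S ` I = {}" "k \<le> card A" "finite K"
    and "i \<in> I" "j \<in> I" "S i \<in> K" "S j \<in> K"
  shows "exch I E S i j"
proof -
  have "card A \<le> card (K - S ` I)" using assms by (intro card_mono) auto
  then show ?thesis using assms unfolding interchangeable_def by (meson le_trans)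
qed

text \<open>Two holes \<open>a1\<close>, \<open>a2\<close> and a pebble \<open>e\<close> on
  \<open>b\<close> are parked in the overlap, the third hole elsewhere in \<open>K\<close>. Every
  pebble of \<open>K\<close> is then exchangeable with \<open>e\<close> inside \<open>K\<close>, and
  every pebble of \<open>L\<close> inside \<open>L\<close>.\<close>

lemma interchangeable_Un:
  assumes "sym E" "connected_in E (K \<union> L)" "finite K" "finite L"
    and K: "interchangeable I E 3 K" "4 \<le> card K"
    and L: "interchangeable I E 2 L" "3 \<le> card (K \<inter> L)"
  shows "interchangeable I E 3 (K \<union> L)"
  unfolding interchangeable_def
proof (intro allI impI ballI)
  fix S i j
  assume S: "inj_on S I" "3 \<le> card (K \<union> L - S ` I)"
    and ij: "i \<in> I" "j \<in> I" "S i \<in> K \<union> L" "S j \<in> K \<union> L"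
  obtain B where B: "B \<subseteq> K \<inter> L" "card B = 3" using L(2) by (meson obtain_subset_with_card_n)
  then obtain a1 a2 b where abc: "B = {a1, a2, b}" "a1 \<noteq> a2" "a1 \<noteq> b" "a2 \<noteq> b"
    by (metis card_3_iff)
  have "\<not> K \<subseteq> B" using K(2) B abc card_mono[of B K] by auto
  then obtain a3 where a3: "a3 \<in> K" "a3 \<notin> B" by auto
  let ?A = "{a1, a2, a3}"
  have cA: "card ?A = 3" using abc a3 by auto
  have i: "S i \<in> (K \<union> L) \<inter> S ` I" using ij by auto
  have cb: "card {b} \<le> card ((K \<union> L) \<inter> S ` I)"
    using i assms(3,4) by (auto simp: Suc_le_eq card_gt_0_iff)
  obtain S' where S': "reach I E S S'" "inj_on S' I" "?A \<inter> S' ` I = {}" "{b} \<subseteq> S' ` I"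
      "\<And>i. S' i \<in> K \<union> L \<longleftrightarrow> S i \<in> K \<union> L"
  proof (rule rearrange[OF assms(1,2) _ S(1), of ?A "{b}"])
    show "?A \<inter> {b} = {}" "?A \<subseteq> K \<union> L" "{b} \<subseteq> K \<union> L" using abc B a3 by auto
    show "finite (K \<union> L)" using assms by simp
  qed (use cA cb S(2) in auto)
  obtain e where e: "e \<in> I" "S' e = b" using S'(4) by auto
  have "exch I E S' l e" if l: "l \<in> I" "S l \<in> K \<union> L" for l
  proof (cases "S' l \<in> K")
    case True
    show ?thesis
      by (rule interchangeableD[OF K(1) S'(2) _ S'(3)]) (use True e l cA abc B a3 assms in auto)
  next
    case False
    then have "S' l \<in> L" using S'(5) l by auto
    moreover have "{a1, a2} \<inter> S' ` I = {}" using S'(3) by auto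
    ultimately show ?thesis
      by (intro interchangeableD[OF L(1) S'(2), of "{a1, a2}"]) (use e l abc B assms in auto)
  qed
  then have "exch I E S' i j" using ij e(1) by (meson exch_sym exch_trans)
  then show "exch I E S i j" using exch_reach[OF assms(1) S(1) S'(1)] ij by blast
qed

text \<open>The sets share only \<open>x\<close> and \<open>v\<close>, too few for two holes and a
  common pebble. With holes on \<open>x\<close>, \<open>v\<close> and \<open>a\<close>, pebbles of
  \<open>K\<close> are exchangeable with \<open>e\<close> on \<open>b\<close>, those of
  \<open>L\<close> with \<open>f\<close> on \<open>c\<close>. To link the two classes,
  \<open>f\<close> steps from \<open>c\<close> to \<open>v\<close>; now \<open>e\<close> and
  \<open>f\<close> are both in \<open>L'\<close>, where \<open>x\<close> and \<open>a\<close> are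
  holes.\<close>

lemma interchangeable_Un_bridge:
  assumes "sym E" "connected_in E (K \<union> L)" "finite K" "finite L"
    and K: "interchangeable I E 3 K"
    and L: "interchangeable I E 2 L" "x \<in> L" "v \<in> L" "K \<inter> L \<subseteq> {x, v}" "(v, c) \<in> E" "c \<in> L - {x, v}"
    and L': "interchangeable I E 2 L'" "x \<in> L'" "v \<in> L'" "x \<noteq> v" "L' \<subseteq> K" "4 \<le> card L'"
  shows "interchangeable I E 3 (K \<union> L)"
  unfolding interchangeable_def
proof (intro allI impI ballI)
  fix S i j
  assume S: "inj_on S I" "3 \<le> card (K \<union> L - S ` I)"
    and ij: "i \<in> I" "j \<in> I" "S i \<in> K \<union> L" "S j \<in> K \<union> L"
  show "exch I E S i j"
  proof (cases "i = j")
    case ne: False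
    have cL': "card (L' - {x, v}) \<ge> 2"
      using L' assms(3) finite_subset[of L' K] by (simp add: card_Diff_subset)
    obtain B where B: "B \<subseteq> L' - {x, v}" "card B = 2" using cL' by (meson obtain_subset_with_card_n)
    then obtain a b where ab: "B = {a, b}" "a \<noteq> b" by (metis card_2_iff)
    have cK: "c \<notin> K" using L by auto
    let ?A = "{x, v, a}" and ?B = "{b, c}"
    have cA: "card ?A = 3" and cB: "card ?B = 2" using ab B L' L cK by (auto simp: card_insert_if)
    have "{S i, S j} \<subseteq> (K \<union> L) \<inter> S ` I" using ij by auto
    moreover have "S i \<noteq> S j" using ne ij S(1) by (auto dest: inj_onD)
    ultimately have 2: "2 \<le> card ((K \<union> L) \<inter> S ` I)"
      using card_mono[of "(K \<union> L) \<inter> S ` I" "{S i, S j}"] assms(3,4) by auto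
    obtain S' where S': "reach I E S S'" "inj_on S' I" "?A \<inter> S' ` I = {}" "?B \<subseteq> S' ` I"
        "\<And>i. S' i \<in> K \<union> L \<longleftrightarrow> S i \<in> K \<union> L"
    proof (rule rearrange[OF assms(1,2) _ S(1), of ?A ?B])
      show "?A \<inter> ?B = {}" "?A \<subseteq> K \<union> L" "?B \<subseteq> K \<union> L" using ab B L L' cK by auto
      show "finite (K \<union> L)" using assms by simp
    qed (use cA cB S(2) 2 in auto)
    obtain e where e: "e \<in> I" "S' e = b" using S'(4) by auto
    obtain f where f: "f \<in> I" "S' f = c" using S'(4) by auto
    let ?S = "S'(f := v)"
    have s: "slide I E S' ?S"
      using f S'(3) L(5) assms(1) by (intro slideI) (auto dest: symD)
    have bc: "b \<noteq> c" using cB by auto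
    have ef: "exch I E S' e f"
    proof (rule exch_reach[OF assms(1) S'(2) slide_reach[OF s] e(1) f(1)])
      show "exch I E ?S e f"
      proof (rule interchangeableD[OF L'(1) slide_inj[OF s S'(2)], of "{x, a}"])
        show "{x, a} \<inter> ?S ` I = {}"
          using slide_image[OF S'(2) f(1), of v] S'(3) L'(4) ab B by auto
      qed (use L' L ab B e f assms finite_subset[of L' K] bc in auto)
    qed
    have K': "exch I E S' l e" if l: "l \<in> I" "S' l \<in> K" for l
      by (rule interchangeableD[OF K S'(2) _ S'(3)]) (use l e cA ab B L L' assms in auto)
    have "exch I E S' l e" if l: "l \<in> I" "S l \<in> K \<union> L" for l
    proof (cases "S' l \<in> K")
      case True
      then show ?thesis using K' l by blast
    next
      case False
      then have "S' l \<in> L" using S'(5) l by auto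
      then have "exch I E S' l f"
        by (intro interchangeableD[OF L(1) S'(2), of "{x, v}"]) (use S'(3) L L' f l assms in auto)
      then show ?thesis using ef l e f by (meson exch_sym exch_trans)
    qed
    then have "exch I E S' i j" using ij e(1) by (meson exch_sym exch_trans)
    then show "exch I E S i j" using exch_reach[OF assms(1) S(1) S'(1)] ij by blast
  qed simp
qed

text \<open>The attaching vertex \<open>v\<close> is added first, as the pendant vertex of the cycle
  \<open>z\<close>. How \<open>y\<close> is added then depends on whether it covers
  \<open>K\<close>, meets the enlarged set only in \<open>v\<close>, or meets it in a further
  vertex.\<close>

lemma interchangeable_add_cycle:
  assumes "sym E" "finite V" "connected_in E V" "K \<subseteq> V" "connected_in E K" "interchangeable I E 3 K"
    and Z1: "cyc E m z" "range z \<subseteq> K" "x \<in> range z"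
    and v: "v \<notin> K" "(x, v) \<in> E"
    and Z: "cyc E n y" "range y \<subseteq> V" "range y \<noteq> V" "v \<in> range y"
  shows "interchangeable I E 3 (K \<union> range y)"
proof -
  have fin: "finite K" "finite (range z)" "finite (range y)"
    using assms(2,4) finite_subset finite_range_cyc Z1(1) Z(1) by blast+
  let ?L = "insert v (range z)" and ?K = "insert v K"
  have vz: "v \<notin> range z" using v(1) Z1(2) by auto
  have L: "interchangeable I E 2 ?L"
    using interchangeable_lollipop[OF Z1(1) assms(1) vz Z1(3) v(2)] .
  have cL: "card ?L \<ge> 4" using vz fin card_range_cyc[OF Z1(1)] cycD(1)[OF Z1(1)] by simp
  have "card ?L \<le> card ?K" using Z1(2) fin by (intro card_mono) auto
  then have cK: "4 \<le> card ?K" using cL by simp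
  have connK: "connected_in E ?K" using connected_in_insert[OF assms(1,5) _ v(2)] Z1 by auto
  \<comment> \<open>If \<open>K\<close> is just the cycle \<open>z\<close>, then \<open>?K\<close>
    is a lollipop. Otherwise \<open>K\<close> has a fourth vertex and overlaps the lollipop
    \<open>?L\<close> in the whole cycle.\<close>
  have K: "interchangeable I E 3 ?K"
  proof (cases "K = range z")
    case True
    then show ?thesis using interchangeable_mono[OF L, of ?K 3] fin by simp
  next
    case False
    then have "range z \<subset> K" using Z1(2) by auto
    then have "card (range z) < card K" using fin psubset_card_mono by blast
    then have "4 \<le> card K" using card_range_cyc[OF Z1(1)] cycD(1)[OF Z1(1)] by simp
    moreover have eq: "K \<union> ?L = ?K" "K \<inter> ?L = range z" using Z1(2) v(1) by auto
    ultimately show ?thesis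
      using interchangeable_Un[OF assms(1), of K ?L I] connK fin assms(6) L
        card_range_cyc[OF Z1(1)] cycD(1)[OF Z1(1)] by simp
  qed
  have eqU: "K \<union> range y = ?K \<union> range y" using Z(4) by auto
  have conny: "connected_in E (range y)" using connected_in_cyc[OF assms(1) Z(1)] .
  have connU: "connected_in E (?K \<union> range y)"
    using connected_in_Un[OF assms(1) connK conny, of v v] Z(4) by auto
  consider "?K \<subseteq> range y" | "range y \<inter> ?K = {v}" | u where "\<not> ?K \<subseteq> range y" "u \<in> range y \<inter> ?K" "u \<noteq> v"
    using Z(4) by blast
  then show ?thesis
  proof cases
    case 1
    \<comment> \<open>As \<open>y\<close> covers \<open>?K\<close> but not \<open>V\<close>, an edge
      leaving it serves as pendant edge.\<close>
    obtain a w where "a \<in> range y" "w \<in> V - range y" "(a, w) \<in> E"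
      using connected_in_boundary[OF assms(3) Z(2) _ Z(3)] by blast
    then have "interchangeable I E 2 (insert w (range y))"
      using interchangeable_lollipop[OF Z(1) assms(1)] by auto
    then have "interchangeable I E 3 (range y)" using fin by (auto intro: interchangeable_mono)
    moreover have "K \<union> range y = range y" using 1 by auto
    ultimately show ?thesis by simp
  next
    case 2
    \<comment> \<open>The edge between \<open>x\<close> and \<open>v\<close> serves as the bridge:
      \<open>x\<close> is the pendant vertex of \<open>y\<close>, and \<open>v\<close> that of
      \<open>z\<close>.\<close>
    have xK: "x \<in> K" using Z1 by auto
    then have xy: "x \<notin> range y" using 2 v(1) by auto
    have vx: "(v, x) \<in> E" using v(2) assms(1) by (auto dest: symD)
    obtain c where c: "v = y c" using Z(4) by auto
    have yc: "y (Suc c) \<noteq> v"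
      using c cyc_eq_iff[OF Z(1), of "Suc c" c] cycD(1)[OF Z(1)] by (auto simp: mod_Suc split: if_splits)
    have eq: "?K \<union> insert x (range y) = ?K \<union> range y" using xK by auto
    have "interchangeable I E 3 (?K \<union> insert x (range y))"
    proof (rule interchangeable_Un_bridge[OF assms(1) _ _ _ K _ _ _ _ _ _ L])
      show "interchangeable I E 2 (insert x (range y))"
        using interchangeable_lollipop[OF Z(1) assms(1) xy Z(4) vx] .
      show "connected_in E (?K \<union> insert x (range y))" unfolding eq by (rule connU)
      show "finite ?K" "finite (insert x (range y))" using fin by simp_all
      show "?K \<inter> insert x (range y) \<subseteq> {x, v}" using 2 by blast
      show "(v, y (Suc c)) \<in> E" using cycD(4)[OF Z(1)] c by simp
      show "y (Suc c) \<in> insert x (range y) - {x, v}" using yc xy by auto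
      show "x \<noteq> v" using xK v(1) by auto
      show "?L \<subseteq> ?K" using Z1(2) by auto
    qed (use Z(4) Z1(3) cL in auto)
    then show ?thesis unfolding eq eqU .
  next
    case 3
    \<comment> \<open>A pendant vertex \<open>w\<close> of \<open>y\<close> is chosen inside
      \<open>?K\<close>, so that the lollipop shares the three vertices \<open>u\<close>,
      \<open>v\<close> and \<open>w\<close> with \<open>?K\<close>.\<close>
    have "connected_in E ?K" by (rule connK)
    then obtain a w where aw: "a \<in> ?K \<inter> range y" "w \<in> ?K - (?K \<inter> range y)" "(a, w) \<in> E"
      by (rule connected_in_boundary[of E ?K "?K \<inter> range y"]) (use 3 in auto)
    then have L2: "interchangeable I E 2 (insert w (range y))"
      using interchangeable_lollipop[OF Z(1) assms(1), of w a] by auto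
    have uw: "u \<in> range y" "u \<in> ?K" "w \<in> ?K" "w \<notin> range y"
      using 3(2) aw(2) by (metis DiffE Int_iff)+
    then have "w \<noteq> u" "w \<noteq> v" using Z(4) by metis+
    then have "card {u, v, w} = 3" using 3(3) by simp
    moreover have "{u, v, w} \<subseteq> ?K \<inter> insert w (range y)" using uw Z(4) by simp
    then have "card {u, v, w} \<le> card (?K \<inter> insert w (range y))"
      using fin by (intro card_mono) simp_all
    ultimately have "3 \<le> card (?K \<inter> insert w (range y))" by simp
    moreover have eq: "?K \<union> insert w (range y) = ?K \<union> range y" using uw(3) by auto
    ultimately have "interchangeable I E 3 (?K \<union> insert w (range y))"
      using interchangeable_Un[OF assms(1) _ _ _ K cK L2] connU fin by simp
    then show ?thesis unfolding eq eqU .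
  qed
qed

text \<open>A largest set built up from cycles must be \<open>V\<close>: an edge leaving it ends on
  a cycle that could still be added. Each cycle being proper in \<open>V\<close> guarantees an edge
  leaving it.\<close>

theorem interchangeable_cycles:
  assumes "sym E" "finite V" "connected_in E V"
    and cyc: "\<And>v. v \<in> V \<Longrightarrow> \<exists>m z. cyc E m z \<and> v \<in> range z \<and> range z \<subset> V"
  shows "interchangeable I E 3 V"
proof (cases "V = {}")
  case True
  then show ?thesis by (simp add: interchangeable_def)
next
  case False
  \<comment> \<open>The last conjunct supplies the cycle inside \<open>K\<close> through the vertex
    at which the next cycle is attached.\<close>
  define P where "P K \<longleftrightarrow> K \<subseteq> V \<and> K \<noteq> {} \<and> connected_in E K \<and> interchangeable I E 3 K \<and>
    (\<forall>x\<in>K. \<exists>m z. cyc E m z \<and> x \<in> range z \<and> range z \<subseteq> K)" for K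
  obtain v0 where v0: "v0 \<in> V" using False by auto
  obtain m z where z: "cyc E m z" "v0 \<in> range z" "range z \<subset> V" using cyc[OF v0] by blast
  obtain a w where aw: "a \<in> range z" "w \<in> V - range z" "(a, w) \<in> E"
    using connected_in_boundary[OF assms(3), of "range z"] z by blast
  have "interchangeable I E 3 (range z)"
    by (rule interchangeable_mono[OF interchangeable_lollipop[OF z(1) assms(1) _ aw(1,3)]])
      (use aw(2) finite_range_cyc[OF z(1)] in auto)
  then have "P (range z)" unfolding P_def
    using z connected_in_cyc[OF assms(1) z(1)] by blast
  moreover have "\<And>K. P K \<Longrightarrow> card K \<le> card V" unfolding P_def using assms(2) card_mono by blast
  ultimately obtain K where K: "P K" "\<And>K'. P K' \<Longrightarrow> card K' \<le> card K"
    using ex_has_greatest_nat[of P "range z" card "Suc (card V)"] by (auto simp: le_imp_less_Suc)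
  have "K = V"
  proof (rule ccontr)
    assume "K \<noteq> V"
    then obtain x v where xv: "x \<in> K" "v \<in> V - K" "(x, v) \<in> E"
      using connected_in_boundary[OF assms(3), of K] K(1) unfolding P_def by blast
    obtain n y where y: "cyc E n y" "v \<in> range y" "range y \<subset> V" using cyc xv by blast
    obtain m z where z: "cyc E m z" "x \<in> range z" "range z \<subseteq> K" using K(1) xv unfolding P_def by blast
    have PK: "K \<subseteq> V" "connected_in E K" "interchangeable I E 3 K" using K(1) unfolding P_def by auto
    have "interchangeable I E 3 (K \<union> range y)"
      by (rule interchangeable_add_cycle[OF assms(1-3) PK z(1,3,2) _ xv(3) y(1)]) (use y xv in auto)
    moreover have "connected_in E (K \<union> range y)"
      using connected_in_Un[OF assms(1) PK(2) connected_in_cyc[OF assms(1) y(1)] xv(1) y(2)] xv(3) by blast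
    moreover have "\<exists>m z. cyc E m z \<and> a \<in> range z \<and> range z \<subseteq> K \<union> range y" if "a \<in> K \<union> range y" for a
      using that K(1) y unfolding P_def by (metis Un_iff Un_upper2 le_supI1)
    ultimately have "P (K \<union> range y)" using PK y xv unfolding P_def by auto
    moreover have "card K < card (K \<union> range y)"
      using xv y PK assms(2) finite_subset by (intro psubset_card_mono) (auto intro: finite_subset)
    ultimately show False using K(2) by fastforce
  qed
  then show ?thesis using K(1) unfolding P_def by simp
qed

section \<open>Cycles and contraction\<close>

definition cycle_verts :: "'a rel \<Rightarrow> 'a set" where
  "cycle_verts E = {v. \<exists>m z. cyc E m z \<and> v \<in> range z}"

text \<open>For symmetric \<open>E\<close> and \<open>N\<close> the complement of \<open>M\<close>
  this is the torso of \<open>M\<close>: besides the edges within \<open>M\<close>, any two vertices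
  of \<open>M\<close> attached to the same component of \<open>N\<close> become adjacent.\<close>

definition contract :: "'a rel \<Rightarrow> 'a set \<Rightarrow> 'a set \<Rightarrow> 'a rel" where
  "contract E M N = {(u, v). u \<in> M \<and> v \<in> M \<and> u \<noteq> v \<and> (u, v) \<in> (Restr E (N \<union> {u, v}))\<^sup>*}"

section \<open>Finding cycles\<close>

lemma cyc_closed_path:
  assumes "2 \<le> n" "inj_on f {..n}" "\<And>i. i < n \<Longrightarrow> (f i, f (Suc i)) \<in> E" "(f n, f 0) \<in> E"
  shows "cyc E (Suc n) (\<lambda>k. f (k mod Suc n))" "range (\<lambda>k. f (k mod Suc n)) = f ` {..n}"
proof -
  have "inj_on (\<lambda>k. f (k mod Suc n)) {..<Suc n}"
    using assms(2) by (auto simp: inj_on_def)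
  moreover have "(f (i mod Suc n), f (Suc i mod Suc n)) \<in> E" for i
  proof (cases "i mod Suc n = n")
    case True
    then show ?thesis using assms(4) by (simp add: mod_Suc)
  next
    case False
    then have "i mod Suc n < n" using mod_less_divisor[of "Suc n" i] by linarith
    then show ?thesis using assms(3) by (simp add: mod_Suc)
  qed
  moreover have "(i + Suc n) mod Suc n = i mod Suc n" for i by (rule mod_add_self2)
  ultimately show "cyc E (Suc n) (\<lambda>k. f (k mod Suc n))" using assms(1) unfolding cyc_def by auto
  show "range (\<lambda>k. f (k mod Suc n)) = f ` {..n}"
  proof
    show "range (\<lambda>k. f (k mod Suc n)) \<subseteq> f ` {..n}"
      using mod_less_divisor[of "Suc n"] by (auto simp: less_Suc_eq_le)
    show "f ` {..n} \<subseteq> range (\<lambda>k. f (k mod Suc n))"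
    proof
      fix x assume "x \<in> f ` {..n}"
      then obtain k where "x = f k" "k \<le> n" by auto
      then have "x = f (k mod Suc n)" by simp
      then show "x \<in> range (\<lambda>k. f (k mod Suc n))" by blast
    qed
  qed
qed

lemma relpow_segment:
  assumes "\<And>i. i < n \<Longrightarrow> (f i, f (Suc i)) \<in> R" "a \<le> b" "b \<le> n"
  shows "(f a, f b) \<in> R ^^ (b - a)"
  unfolding relpow_fun_conv using assms by (intro exI[of _ "\<lambda>i. f (a + i)"]) auto

text \<open>A shortest walk from \<open>u\<close> to \<open>v\<close> in \<open>R\<close> repeats no
  vertex and, the edge itself not being in \<open>R\<close>, has length at least two. The edge from
  \<open>v\<close> to \<open>u\<close> closes it to a cycle.\<close>

lemma cyc_through_edge:
  assumes "(u, v) \<in> R\<^sup>*" "R \<subseteq> E" "(v, u) \<in> E" "(u, v) \<notin> R" "u \<noteq> v"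
  shows "\<exists>m z. cyc E m z \<and> v \<in> range z"
proof -
  define n where "n = (LEAST n. (u, v) \<in> R ^^ n)"
  have "\<exists>n. (u, v) \<in> R ^^ n" using assms(1) by (simp add: rtrancl_power)
  then have n: "(u, v) \<in> R ^^ n" unfolding n_def by (metis LeastI)
  have least: "n \<le> k" if "(u, v) \<in> R ^^ k" for k unfolding n_def using that by (rule Least_le)
  obtain f where f: "f 0 = u" "f n = v" "\<And>i. i < n \<Longrightarrow> (f i, f (Suc i)) \<in> R"
    using n unfolding relpow_fun_conv by blast
  have "n \<noteq> 0" using f(1,2) assms(5) by metis
  moreover have "n \<noteq> 1" using f(1,2) f(3)[of 0] assms(4) by auto
  ultimately have "2 \<le> n" by linarith
  moreover have "inj_on f {..n}"
  proof (rule linorder_inj_onI')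
    fix a b assume ab: "a \<in> {..n}" "b \<in> {..n}" "a < b"
    show "f a \<noteq> f b"
    proof
      assume "f a = f b"
      moreover have "(f 0, f a) \<in> R ^^ (a - 0)" "(f b, f n) \<in> R ^^ (n - b)"
        using ab by (intro relpow_segment[of n f R] f(3); simp)+
      \<comment> \<open>Cutting out the part between the two equal vertices would shorten the
        walk.\<close>
      ultimately have "(u, v) \<in> R ^^ (a + (n - b))"
        using f(1,2) by (auto simp: relpow_add)
      then show False using least[of "a + (n - b)"] ab by simp
    qed
  qed
  ultimately have "cyc E (Suc n) (\<lambda>k. f (k mod Suc n))" "v \<in> range (\<lambda>k. f (k mod Suc n))"
    using cyc_closed_path[of n f E] f assms(2,3) by auto
  then show ?thesis by blast
qed

text \<open>The chord closes each of the two arcs between its ends to a smaller cycle, and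
  \<open>v\<close> lies on one of them. The indices are shifted so that \<open>s\<close> is
  \<open>y 0\<close> and \<open>t\<close> is \<open>y b\<close>.\<close>

lemma cyc_chord:
  assumes "cyc E m z" "sym E" "irrefl E" "s \<in> range z" "t \<in> range z" "(s, t) \<in> E"
    and chord: "\<And>i. (s, t) \<noteq> (z i, z (Suc i))" "\<And>i. (t, s) \<noteq> (z i, z (Suc i))"
    and "v \<in> range z"
  shows "\<exists>n y. cyc E n y \<and> v \<in> range y \<and> range y \<subset> range z"
proof -
  obtain a where a: "s = z a" using assms(4) by auto
  define y where "y i = z (i + a)" for i
  have c: "cyc E m y" unfolding y_def by (rule cyc_shift[OF assms(1)])
  have m: "3 \<le> m" using cycD(1)[OF c] .
  have "range y \<subseteq> range z" unfolding y_def by auto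
  then have ry: "range y = range z"
    using card_range_cyc[OF c] card_range_cyc[OF assms(1)] finite_range_cyc[OF assms(1)]
    by (intro card_subset_eq) auto
  obtain b where b: "t = y b" "b < m" using assms(5) range_cyc[OF c] ry by auto
  have s: "s = y 0" using a y_def by simp
  have b0: "b \<noteq> 0" using assms(3,6) s b(1) by (metis irrefl_def)
  have b1: "b \<noteq> 1" using chord(1)[of a] s b a by (auto simp: y_def)
  have bm: "b \<noteq> m - 1"
  proof
    assume "b = m - 1"
    then have "y (Suc b) = s" using cycD(3)[OF c, of 0] m s by simp
    then show False using chord(2)[of "b + a"] b by (simp add: y_def)
  qed
  obtain d where d: "v = y d" "d < m" using assms(9) range_cyc[OF c] ry by auto
  have inj: "y i = y j \<longleftrightarrow> i = j" if "i < m" "j < m" for i j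
    using cyc_eq_iff[OF c, of i j] that by simp
  show ?thesis
  proof (cases "d \<le> b")
    case True
    have "2 \<le> b" using b0 b1 by linarith
    moreover have "inj_on y {..b}" using inj b(2) by (auto simp: inj_on_def)
    moreover have "(y b, y 0) \<in> E" using symD[OF assms(2,6)] s b(1) by simp
    ultimately obtain n w where w: "cyc E n w" "range w = y ` {..b}"
      using cyc_closed_path[of b y E] cycD(4)[OF c] by blast
    \<comment> \<open>The vertex following \<open>t\<close> lies strictly inside the other
      arc.\<close>
    have "y (Suc b) \<noteq> y i" if "i \<le> b" for i using inj[of "Suc b" i] that b(2) bm by simp
    then have "y (Suc b) \<notin> y ` {..b}" by auto
    then have "y ` {..b} \<noteq> range y" using rangeI[of y "Suc b"] by metis
    then have "y ` {..b} \<subset> range y" by (simp add: image_mono psubset_eq)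
    moreover have "v \<in> y ` {..b}" using d True by auto
    ultimately show ?thesis using w ry by metis
  next
    case False
    \<comment> \<open>The second arc runs from \<open>y b\<close> to \<open>y m\<close>, which is
      \<open>y 0\<close>; it misses \<open>y 1\<close>.\<close>
    define n where "n = m - b"
    define f where "f i = y (b + i)" for i
    have n: "b + n = m" "2 \<le> n" unfolding n_def using b bm by auto
    have fn: "f n = y 0" using cycD(3)[OF c, of 0] n by (simp add: f_def)
    have finj: "inj_on f {..n}"
    proof (rule linorder_inj_onI')
      fix i j assume ij: "i \<in> {..n}" "j \<in> {..n}" "i < j"
      show "f i \<noteq> f j"
      proof (cases "j = n")
        case True
        then show ?thesis using fn ij inj[of "b + i" 0] n b0 by (simp add: f_def)
      next
        case False
        then show ?thesis using ij inj[of "b + i" "b + j"] n by (simp add: f_def)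
      qed
    qed
    have "(f n, f 0) \<in> E" using fn s b(1) assms(6) by (simp add: f_def)
    moreover have "(f i, f (Suc i)) \<in> E" for i using cycD(4)[OF c] by (simp add: f_def)
    ultimately obtain k w where w: "cyc E k w" "range w = f ` {..n}"
      using cyc_closed_path[OF n(2) finj, of E] by blast
    have "y 1 \<notin> f ` {..n}"
    proof
      assume "y 1 \<in> f ` {..n}"
      then obtain i where i: "i \<le> n" "y 1 = f i" by auto
      show False
      proof (cases "i = n")
        case True
        then show False using i fn inj[of 1 0] m by simp
      next
        case False
        then show False using i inj[of 1 "b + i"] n m b0 b1 by (simp add: f_def)
      qed
    qed
    then have "f ` {..n} \<noteq> range y" using rangeI[of y 1] by metis
    moreover have "f ` {..n} \<subseteq> range y" by (auto simp: f_def)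
    ultimately have "f ` {..n} \<subset> range y" by simp
    moreover have "v = f (d - b)" "d - b \<le> n" using d False n by (auto simp: f_def)
    then have "v \<in> f ` {..n}" by blast
    ultimately show ?thesis using w ry by metis
  qed
qed

section \<open>Contracting the vertices off the cycles\<close>

lemma sym_contract:
  assumes "sym E"
  shows "sym (contract E M N)"
proof (rule symI)
  fix u v assume uv: "(u, v) \<in> contract E M N"
  have "sym ((Restr E (N \<union> {u, v}))\<^sup>*)" by (intro sym_rtrancl sym_Restr assms)
  then have "(v, u) \<in> (Restr E (N \<union> {v, u}))\<^sup>*"
    using uv unfolding contract_def by (auto simp: insert_commute dest: symD)
  then show "(v, u) \<in> contract E M N" using uv unfolding contract_def by auto
qed

lemma contract_edge: "(u, v) \<in> E \<Longrightarrow> u \<in> M \<Longrightarrow> v \<in> M \<Longrightarrow> u \<noteq> v \<Longrightarrow> (u, v) \<in> contract E M N"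
  unfolding contract_def by auto

text \<open>Follow a walk of \<open>E\<close> and remember the last vertex \<open>m\<close> of
  \<open>M\<close> on it: since then the walk has stayed in \<open>N\<close>, so the next vertex of
  \<open>M\<close> is joined to \<open>m\<close> by a contracted edge or equals it.\<close>

lemma connected_in_contract:
  assumes "connected_in E (M \<union> N)"
  shows "connected_in (contract E M N) M"
  unfolding connected_in_def
proof (intro ballI)
  fix u v assume uv: "u \<in> M" "v \<in> M"
  let ?C = "Restr (contract E M N) M"
  have 1: "(m, y) \<in> ?C\<^sup>*" if "m \<in> M" "y \<in> M" "(m, y) \<in> (Restr E (N \<union> {m, y}))\<^sup>*" for m y
    using that by (cases "m = y") (auto simp: contract_def)
  have "(u, v) \<in> (Restr E (M \<union> N))\<^sup>*" using assms uv unfolding connected_in_def by blast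
  then have "\<exists>m\<in>M. (u, m) \<in> ?C\<^sup>* \<and> (m, v) \<in> (Restr E (N \<union> {m, v}))\<^sup>*"
  proof (induction rule: rtrancl_induct)
    case base
    then show ?case using uv by blast
  next
    case (step y y')
    then obtain m where m: "m \<in> M" "(u, m) \<in> ?C\<^sup>*" "(m, y) \<in> (Restr E (N \<union> {m, y}))\<^sup>*" by blast
    show ?case
    proof (cases "y \<in> M")
      case True
      then have "(u, y) \<in> ?C\<^sup>*" using 1[OF m(1) True m(3)] m(2) by simp
      moreover have "(y, y') \<in> Restr E (N \<union> {y, y'})" using step(2) by auto
      ultimately show ?thesis using True by blast
    next
      case False
      then have y: "y \<in> N" using step(2) by auto
      then have "(Restr E (N \<union> {m, y}))\<^sup>* \<subseteq> (Restr E (N \<union> {m, y'}))\<^sup>*" by (intro rtrancl_mono) auto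
      moreover have "(y, y') \<in> Restr E (N \<union> {m, y'})" using step(2) y by auto
      ultimately have "(m, y') \<in> (Restr E (N \<union> {m, y'}))\<^sup>*"
        using m(3) by (meson rtrancl.rtrancl_into_rtrancl subsetD)
      then show ?thesis using m by blast
    qed
  qed
  then show "(u, v) \<in> ?C\<^sup>*" using 1 uv by (meson rtrancl_trans)
qed

text \<open>All pebbles stand on \<open>M\<close>, so \<open>N\<close> is empty and a contracted
  move can be carried out by walking through \<open>N\<close>. Each such move again leaves all
  pebbles on \<open>M\<close>.\<close>

lemma reach_contract:
  assumes "sym E" "M \<inter> N = {}" "inj_on S I" "S ` I \<subseteq> M" "reach I (contract E M N) S S'"
  shows "reach I E S S'"
proof -
  have "reach I E S S' \<and> S' ` I \<subseteq> M \<and> inj_on S' I"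
    using assms(5) unfolding reach_def[of I "contract E M N"]
  proof (induction rule: rtranclp_induct)
    case base
    then show ?case using assms by simp
  next
    case (step S1 S2)
    then have S1: "reach I E S S1" "S1 ` I \<subseteq> M" "inj_on S1 I" by auto
    obtain i v where i: "i \<in> I" "(S1 i, v) \<in> contract E M N" "v \<notin> S1 ` I" "S2 = S1(i := v)"
      using step(2) unfolding slide_def by blast
    let ?K = "N \<union> {S1 i, v}"
    have v: "v \<in> M" "(v, S1 i) \<in> (Restr E ?K)\<^sup>*"
      using symD[OF sym_contract[OF assms(1)] i(2)] unfolding contract_def by (auto simp: insert_commute)
    obtain S3 where S3: "reach I (Restr E ?K) S1 S3" "S3 ` I = insert v (S1 ` I - {S1 i})"
      using reach_transfer_hole[OF v(2) sym_Restr[OF assms(1)] S1(3) i(3)] i(1) by blast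
    \<comment> \<open>Pebble \<open>i\<close> is the only one in \<open>?K\<close>, so transferring
      the hole at \<open>v\<close> moves no other pebble and must bring \<open>i\<close> to
      \<open>v\<close>.\<close>
    have *: "S3 k = S1 k" if "k \<noteq> i" for k
    proof (cases "k \<in> I")
      case True
      then have "S1 k \<noteq> S1 i" "S1 k \<noteq> v" "S1 k \<notin> N" using S1 that i assms(2) by (auto dest: inj_onD)
      then show ?thesis using reach_Restr[OF S3(1)] by auto
    next
      case False
      show ?thesis using S3(1) unfolding reach_def
        by (induction rule: rtranclp_induct) (use False in \<open>auto simp: slide_def\<close>)
    qed
    have "S3 i \<in> ?K" using reach_Restr[OF S3(1), of i] by auto
    moreover have "S3 i \<in> insert v (S1 ` I - {S1 i})" using S3(2) i(1) by blast
    ultimately have "S3 i = v" using S1(2) assms(2) by auto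
    then have "S3 = S2" using * i(4) by (auto simp: fun_eq_iff)
    moreover have "reach I E S1 S3" using S3(1) by (rule reach_mono[rotated]) auto
    moreover have "inj_on S2 I" using slide_inj[OF step(2) S1(3)] .
    moreover have "S2 ` I \<subseteq> M" using slide_image[OF S1(3) i(1), of v] S1(2) v(1) i(4) by auto
    ultimately show ?case using S1(1) reach_trans by metis
  qed
  then show ?thesis by blast
qed

section \<open>Pebble permutations\<close>

text \<open>The hypothesis \<open>noncycle\<close> says that a cycle through all of \<open>V\<close>
  never accounts for every edge; this is what yields a chord.\<close>

lemma reach_permuted_noncycle:
  assumes E: "sym E" "irrefl E" "E \<subseteq> V \<times> V" and V: "finite V" "connected_in E V"
    and I: "finite I" "card I + 3 \<le> card (cycle_verts E)"
    and noncycle: "\<And>m z. cyc E m z \<Longrightarrow> range z = V \<Longrightarrow>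
      E \<noteq> range (\<lambda>i. (z i, z (Suc i))) \<union> (range (\<lambda>i. (z i, z (Suc i))))\<inverse>"
    and S: "inj_on S I" "S ` I \<subseteq> V" and \<pi>: "\<pi> permutes I"
  shows "reach I E S (S \<circ> \<pi>)"
proof -
  define M where "M = cycle_verts E"
  have cycM: "range z \<subseteq> M" if "cyc E m z" for m z
    using that unfolding M_def cycle_verts_def by blast
  have MV: "M \<subseteq> V"
  proof
    fix v assume "v \<in> M"
    then obtain m z k where "cyc E m z" "v = z k" unfolding M_def cycle_verts_def by blast
    then show "v \<in> V" using cycD(4)[of E m z k] E(3) by auto
  qed
  then have fM: "finite M" using V(1) finite_subset by blast
  have cS: "card (S ` I) = card I" using S(1) by (rule card_image)
  \<comment> \<open>Since \<open>card I\<close> is less than \<open>card M\<close>, there are enough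
    holes to empty all of \<open>V - M\<close>.\<close>
  have "card (V - M) = card V - card M" using MV fM by (simp add: card_Diff_subset)
  moreover have "card (V - S ` I) = card V - card I" using S I(1) cS by (simp add: card_Diff_subset)
  ultimately have "card (V - M) \<le> card (V - S ` I)" using I(2) unfolding M_def by simp
  then obtain S0 where S0: "reach I E S S0" "inj_on S0 I" "(V - M) \<inter> S0 ` I = {}"
      and S0V: "\<And>i. S0 i \<in> V \<longleftrightarrow> S i \<in> V"
    using rearrange[OF E(1) V(2,1) S(1), of "V - M" "{}"]
    by (metis Diff_subset Int_empty_right card.empty empty_subsetI zero_le)
  have S0M: "S0 ` I \<subseteq> M" using S0(3) S0V S(2) by auto
  have hole: "3 \<le> card (M - S0 ` I)"
    using S0M fM I card_image[OF S0(2)] unfolding M_def by (simp add: card_Diff_subset)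
  have "exch I E S0 i j" if ij: "i \<in> I" "j \<in> I" for i j
  proof (cases "\<forall>v\<in>M. \<exists>m z. cyc E m z \<and> v \<in> range z \<and> range z \<noteq> M")
    case True
    let ?F = "contract E M (V - M)"
    have "M \<union> (V - M) = V" using MV by auto
    then have conn: "connected_in ?F M" using connected_in_contract[of E M "V - M"] V(2) by simp
    have "interchangeable I ?F 3 M"
    proof (rule interchangeable_cycles[OF sym_contract[OF E(1)] fM conn])
      fix v assume "v \<in> M"
      then obtain m z where z: "cyc E m z" "v \<in> range z" "range z \<noteq> M" using True by blast
      have "(z i, z (Suc i)) \<in> ?F" for i
        using cycD(4)[OF z(1), of i] cycM[OF z(1)] E(2) by (intro contract_edge) (auto simp: irrefl_def)
      then have "cyc ?F m z" using z(1) unfolding cyc_def by blast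
      then show "\<exists>m z. cyc ?F m z \<and> v \<in> range z \<and> range z \<subset> M" using z cycM[OF z(1)] by blast
    qed
    then have "exch I ?F S0 i j"
      using S0(2) hole S0M ij unfolding interchangeable_def by blast
    then show ?thesis unfolding exch_def by (intro reach_contract[OF E(1) _ S0(2) S0M]) auto
  next
    case False
    then obtain v where v: "v \<in> M" "\<And>m z. cyc E m z \<Longrightarrow> v \<in> range z \<Longrightarrow> range z = M" by blast
    then obtain m z where z: "cyc E m z" "v \<in> range z" unfolding M_def cycle_verts_def by blast
    have zM: "range z = M" using v z by blast
    have "M \<noteq> V"
    \<comment> \<open>If the cycle \<open>z\<close> filled \<open>V\<close>, an edge outside it
      would be a chord and give a smaller cycle through \<open>v\<close>, contrary to the choice of
      \<open>v\<close>.\<close>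
    proof
      assume MV': "M = V"
      let ?C = "range (\<lambda>i. (z i, z (Suc i)))"
      have "?C \<union> ?C\<inverse> \<subseteq> E" using cycD(4)[OF z(1)] E(1) by (auto dest: symD)
      then obtain s t where st: "(s, t) \<in> E" "(s, t) \<notin> ?C \<union> ?C\<inverse>"
        using noncycle[OF z(1)] zM MV' by auto
      have "s \<in> range z" "t \<in> range z" using st(1) E(3) zM MV' by auto
      moreover have "(s, t) \<noteq> (z i, z (Suc i))" "(t, s) \<noteq> (z i, z (Suc i))" for i
        using st(2) by blast+
      ultimately obtain n y where "cyc E n y" "v \<in> range y" "range y \<subset> range z"
        using cyc_chord[OF z(1) E(1,2) _ _ st(1) _ _ z(2)] by blast
      then show False using v(2) zM by blast
    qed
    \<comment> \<open>An edge leaving \<open>M\<close> makes the cycle a lollipop, for which two of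
      the holes in \<open>M\<close> suffice.\<close>
    then obtain a w where aw: "a \<in> M" "w \<in> V - M" "(a, w) \<in> E"
      using connected_in_boundary[OF V(2) MV] v(1) by blast
    then have L: "interchangeable I E 2 (insert w M)"
      using interchangeable_lollipop[OF z(1) E(1), of w a] zM by auto
    show ?thesis
      by (rule interchangeableD[OF L S0(2), of "M - S0 ` I"]) (use hole fM ij S0M in auto)
  qed
  then have 1: "reach I E S0 (S0 \<circ> \<pi>)" using reach_permuted[OF I(1) _ \<pi>] by blast
  \<comment> \<open>The gathering walk is reversed and relabelled by \<open>\<pi>\<close>.\<close>
  have "reach I E (S0 \<circ> \<pi>) (S \<circ> \<pi>)"
    using reach_relabel[OF \<pi> reach_sym[OF E(1) S(1) S0(1)]] .
  then show ?thesis using S0(1) 1 by (meson reach_trans)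
qed

section \<open>Library graphs as relations\<close>

lemma connected_rtrancl:
  assumes "Digraph_Component.connected (with_proj H)" "sym (parcs H)" "u \<in> pverts H" "v \<in> pverts H"
  shows "(u, v) \<in> (parcs H)\<^sup>*"
proof -
  \<comment> \<open>Connectedness is defined through the symmetric closure, which adds nothing to
    symmetric arcs.\<close>
  have "parcs (mk_symmetric (with_proj H)) = parcs H"
    using assms(2) by (force simp: parcs_mk_symmetric dest: symD)
  moreover have "(u, v) \<in> rtrancl_on (pverts H) (parcs (mk_symmetric (with_proj H)))"
    using assms unfolding Digraph_Component.connected_def strongly_connected_def reachable_def by simp
  ultimately show ?thesis using rtrancl_on_rtranclI by metis
qed

lemma pair_graphD:
  assumes "pair_graph G"
  shows "sym (parcs G)" "irrefl (parcs G)" "parcs G \<subseteq> pverts G \<times> pverts G" "finite (pverts G)"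
proof -
  interpret pair_graph G by fact
  show "sym (parcs G)" using pair_sym_arcs by (simp add: symmetric_def)
  show "irrefl (parcs G)" using pair_no_loops by (fastforce simp: irrefl_def)
  show "parcs G \<subseteq> pverts G \<times> pverts G" using in_arcsD1 in_arcsD2 by auto
  show "finite (pverts G)" by (rule pair_finite_verts)
qed

text \<open>Each vertex \<open>v\<close> has an edge to some \<open>x\<close>. Deleting it leaves
  \<open>x\<close> connected to \<open>v\<close>, and the remaining path together with the edge
  contains a cycle through \<open>v\<close>.\<close>

lemma two_edge_connected_cycle_verts:
  assumes "pair_graph H" "two_edge_connected H" "parcs H \<subseteq> E"
  shows "pverts H \<subseteq> cycle_verts E"
proof
  fix v assume v: "v \<in> pverts H"
  note H = pair_graphD[OF assms(1)]
  have "\<not> pverts H \<subseteq> {v}"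
    using assms(2) card_mono[of "{v}" "pverts H"] unfolding two_edge_connected_def by auto
  then obtain u where u: "u \<in> pverts H" "u \<noteq> v" by auto
  have "(v, u) \<in> (parcs H)\<^sup>*"
    using connected_rtrancl[OF _ H(1) v u(1)] assms(2) unfolding two_edge_connected_def by blast
  then obtain x where x: "(v, x) \<in> parcs H" using u(2) by (metis converse_rtranclE)
  let ?D = "delete_edge H v x"
  have D: "pverts ?D = pverts H" "parcs ?D = parcs H - {(v, x), (x, v)}"
    by (simp_all add: delete_edge_def)
  have "Digraph_Component.connected (with_proj ?D)"
    using assms(2) x unfolding two_edge_connected_def by blast
  moreover have "sym (parcs ?D)" using H(1) unfolding D(2) by (auto simp: sym_def)
  moreover have "x \<in> pverts H" "x \<noteq> v" using x H(2,3) by (auto simp: irrefl_def)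
  ultimately have "(x, v) \<in> (parcs ?D)\<^sup>*" using connected_rtrancl[of ?D x v] v D(1) by simp
  moreover have "parcs ?D \<subseteq> E" "(v, x) \<in> E" "(x, v) \<notin> parcs ?D"
    using D(2) assms(3) x by auto
  ultimately show "v \<in> cycle_verts E"
    using cyc_through_edge[of x v "parcs ?D" E] \<open>x \<noteq> v\<close> unfolding cycle_verts_def by blast
qed

lemma n_M_le_card_cycle_verts:
  assumes "pair_graph G"
  shows "n_M G \<le> card (cycle_verts (parcs G))"
  unfolding n_M_def
proof (rule card_mono)
  note G = pair_graphD[OF assms]
  have "cycle_verts (parcs G) \<subseteq> pverts G"
  proof
    fix v assume "v \<in> cycle_verts (parcs G)"
    then obtain m z k where "cyc (parcs G) m z" "v = z k" unfolding cycle_verts_def by blast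
    then show "v \<in> pverts G" using cycD(4)[of "parcs G" m z k] G(3) by auto
  qed
  then show "finite (cycle_verts (parcs G))" using G(4) finite_subset by blast
  have "pverts H \<subseteq> cycle_verts (parcs G)" if "max_two_edge_connected_component G H" for H
    using that two_edge_connected_cycle_verts[of H "parcs G"]
    unfolding max_two_edge_connected_component_def subgraph_def by simp
  then show "(\<Union>H\<in>{H. max_two_edge_connected_component G H}. pverts H) \<subseteq> cycle_verts (parcs G)"
    by blast
qed

lemma pcas_map_upt: "k \<le> n \<Longrightarrow> pcas (z k) (map (\<lambda>i. (z i, z (Suc i))) [k..<n]) (z n)"
  by (induction k rule: inc_induct) (simp_all add: upt_conv_Cons)

lemma pawalk_verts_map_upt:
  "k \<le> n \<Longrightarrow> pawalk_verts (z k) (map (\<lambda>i. (z i, z (Suc i))) [k..<n]) = map z [k..<Suc n]"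
  by (induction k rule: inc_induct) (simp_all add: upt_conv_Cons)

lemma is_cycle_graphI:
  assumes "cyc (parcs G) m z" "range z = pverts G"
    and "parcs G = range (\<lambda>i. (z i, z (Suc i))) \<union> (range (\<lambda>i. (z i, z (Suc i))))\<inverse>"
  shows "is_cycle_graph G"
proof -
  define c where "c = map (\<lambda>i. (z i, z (Suc i))) [0..<m]"
  have m: "3 \<le> m" using cycD(1)[OF assms(1)] .
  have zm: "z m = z 0" using cycD(3)[OF assms(1), of 0] by simp
  \<comment> \<open>A library cycle must have distinct vertices after the first, here
    \<open>z 1\<close> to \<open>z m\<close>; this is injectivity of the shifted sequence.\<close>
  have cyc': "cyc UNIV m (\<lambda>i. z (i + 1))"
    using cyc_shift[OF assms(1), of 1] unfolding cyc_def by simp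
  have set_c: "set c = range (\<lambda>i. (z i, z (Suc i)))"
  proof
    show "range (\<lambda>i. (z i, z (Suc i))) \<subseteq> set c"
    proof
      fix e assume "e \<in> range (\<lambda>i. (z i, z (Suc i)))"
      then obtain i where "e = (z i, z (Suc i))" by auto
      then have "e = (z (i mod m), z (Suc (i mod m)))"
        using cyc_eq_iff[OF assms(1), of i "i mod m"] cyc_eq_iff[OF assms(1), of "Suc i" "Suc (i mod m)"]
        by (simp add: mod_Suc_eq)
      moreover have "i mod m < m" using m by simp
      ultimately show "e \<in> set c" unfolding c_def by auto
    qed
  qed (auto simp: c_def)
  have "distinct (tl (map z [0..<Suc m]))"
  proof -
    have "tl (map z [0..<Suc m]) = map (\<lambda>i. z (i + 1)) [0..<m]"
      by (simp add: upt_conv_Cons map_Suc_upt[symmetric] del: upt_Suc)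
    then show ?thesis using cycD(2)[OF cyc'] by (simp add: distinct_map atLeast0LessThan)
  qed
  moreover have "pawalk_verts (z 0) c = map z [0..<Suc m]"
    unfolding c_def using pawalk_verts_map_upt[of 0 m z] by simp
  moreover have "pcas (z 0) c (z 0)" unfolding c_def using pcas_map_upt[of 0 m z] zm by simp
  moreover have "set c \<subseteq> parcs G" using set_c assms(3) by auto
  moreover have "z 0 \<in> pverts G" using assms(2) by auto
  moreover have "c \<noteq> []" using m by (auto simp: c_def)
  ultimately have "pre_digraph.cycle (with_proj G) c"
    unfolding pre_digraph.cycle_def pre_digraph.awalk_def
    by (intro exI[of _ "z 0"]) (simp add: cas_with_proj_eq awalk_verts_with_proj_eq)
  moreover have "3 \<le> length c" using m by (simp add: c_def)
  moreover have "pverts G = fst ` set c" unfolding set_c using assms(2) by (simp add: image_image)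
  moreover have "parcs G = set c \<union> (set c)\<inverse>" unfolding set_c by (rule assms(3))
  ultimately show ?thesis unfolding is_cycle_graph_def by blast
qed

section \<open>Slides as pebble moves\<close>

lemma slide_pebble_move:
  assumes "configuration G p S" "slide {1..p} (parcs G) S S'" "parcs G \<subseteq> pverts G \<times> pverts G"
  shows "pebble_move G p S S'"
proof -
  obtain i v where i: "i \<in> {1..p}" "(S i, v) \<in> parcs G" "v \<notin> S ` {1..p}" "S' = S(i := v)"
    using assms(2) unfolding slide_def by blast
  have "inj_on S' {1..p}" using slide_inj[OF assms(2)] assms(1) unfolding configuration_def by blast
  moreover have "S' \<in> {1..p} \<rightarrow>\<^sub>E pverts G"
  proof -
    have "v \<in> pverts G" using i(2) assms(3) by blast
    moreover have "insert i {1..p} = {1..p}" using i(1) by blast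
    ultimately show ?thesis
      using assms(1) i(4)
        PiE_fun_upd[of v "\<lambda>_. pverts G" i S "{1..p}"] unfolding configuration_def by simp
  qed
  ultimately have "configuration G p S'" unfolding configuration_def by blast
  moreover have "S i \<noteq> v" using i by auto
  then have "{j \<in> {1..p}. S j \<noteq> S' j} = {i}" using i(1,4) by auto
  moreover have "(S i, S' i) \<in> parcs G" using i by simp
  ultimately show ?thesis using assms(1) unfolding pebble_move_def by blast
qed

lemma reach_config_connected:
  assumes "configuration G p S" "reach {1..p} (parcs G) S S'" "parcs G \<subseteq> pverts G \<times> pverts G"
  shows "config_connected G p S S'"
proof -
  have "config_connected G p S S' \<and> configuration G p S'"
    using assms(2) unfolding reach_def config_connected_def
  proof (induction rule: rtranclp_induct)
    case (step S1 S2)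
    then have "pebble_move G p S1 S2" using slide_pebble_move assms(3) by blast
    moreover from this have "configuration G p S2" unfolding pebble_move_def by blast
    ultimately show ?case using step by (meson rtranclp.rtrancl_into_rtrancl)
  qed (use assms(1) in simp)
  then show ?thesis by blast
qed

theorem theorem5:
  fixes G :: "'a pair_pre_digraph" and p :: nat and S :: "nat \<Rightarrow> 'a" and \<pi> :: "nat \<Rightarrow> nat"
  assumes "pair_graph G"
    and "Digraph_Component.connected (with_proj G)"
    and "\<not> is_cycle_graph G"
    and "pebble_permutation_instance G p S \<pi>"
    and "int p \<le> int (n_M G) - 3"
  shows "feasible G p S \<pi>"
proof -
  note G = pair_graphD[OF assms(1)]
  have S: "configuration G p S" "\<pi> permutes {1..p}"
    using assms(4) unfolding pebble_permutation_instance_def by auto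
  then have S': "inj_on S {1..p}" "S ` {1..p} \<subseteq> pverts G" "S \<in> extensional {1..p}"
    unfolding configuration_def by (auto simp: PiE_def)
  have "Restr (parcs G) (pverts G) = parcs G" using G(3) by auto
  then have conn: "connected_in (parcs G) (pverts G)"
    unfolding connected_in_def using connected_rtrancl[OF assms(2) G(1)] by simp
  have "reach {1..p} (parcs G) S (S \<circ> \<pi>)"
  proof (rule reach_permuted_noncycle[OF G(1-4) conn _ _ _ S'(1,2) S(2)])
    \<comment> \<open>Integer subtraction does not truncate, so the bound on \<open>p\<close> forces
      \<open>n_M G\<close> to be at least 3.\<close>
    show "card {1..p} + 3 \<le> card (cycle_verts (parcs G))"
      using assms(5) n_M_le_card_cycle_verts[OF assms(1)] by simp
    show "parcs G \<noteq> range (\<lambda>i. (z i, z (Suc i))) \<union> (range (\<lambda>i. (z i, z (Suc i))))\<inverse>"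
      if "cyc (parcs G) m z" "range z = pverts G" for m z
      using is_cycle_graphI[OF that] assms(3) by blast
  qed simp
  \<comment> \<open>Off \<open>{1..p}\<close> the permutation is the identity and \<open>S\<close>
    is \<open>undefined\<close>, so both functions agree there too.\<close>
  moreover have "S \<circ> \<pi> = (\<lambda>i\<in>{1..p}. S (\<pi> i))"
    using S'(3) permutes_not_in[OF S(2)] by (auto simp: fun_eq_iff extensional_def)
  ultimately show ?thesis
    unfolding feasible_def using reach_config_connected[OF S(1) _ G(3)] by simp
qed

end
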